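(* Let $q=2^m$ with $m\ge 2$. For every subset $S\subset(\mathbb{Z}/q\mathbb{Z})^\times$ one has, as $x\to\infty$, $$P_S(x)=\left(\prod_{a\in S}\left(\frac{C(q,a)^2}{D(q,a)}\right)^{\chi_4(a)}\right)(\log x)^{-2\mu(S)/\varphi(q)}\,(1+o(1)).$$ In particular, the constant $K(q,S)\in(0,\infty)$ determined by $P_S(x)=K(q,S)(\log x)^{-2\mu(S)/\varphi(q)}(1+o(1))$ as $x\to\infty$ is $$K(q,S)=\prod_{a\in S}\left(\frac{C(q,a)^2}{D(q,a)}\right)^{\chi_4(a)}.$$ If $\mu(S)=0$, then $$\lim_{x\to\infty}P_S(x)=\prod_{a\in S}\left(\frac{C(q,a)^2}{D(q,a)}\right)^{\chi_4(a)}.$$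
   Context: Throughout, $p$ denotes an odd prime. The function $\chi_4$ is given on odd integers by $\chi_4(n)=1$ if $n\equiv 1\pmod 4$ and $\chi_4(n)=-1$ if $n\equiv 3\pmod 4$. For an odd prime $p$ set $A(p)=\dfrac{p-\chi_4(p)}{p+\chi_4(p)}$. Here $(\mathbb{Z}/q\mathbb{Z})^\times$ is the group of reduced residue classes modulo $q$ and $\varphi$ is Euler's totient function. Since $4\mid q$, each $a\in(\mathbb{Z}/q\mathbb{Z})^\times$ has a well-defined value $\chi_4(a)\in\{\pm1\}$. For $S\subset(\mathbb{Z}/q\mathbb{Z})^\times$ define $$P_S(x)=\prod_{\substack{p\le x\\ p\bmod q\in S}}A(p),\qquad \mu(S)=\sum_{a\in S}\chi_4(a).$$ For each $a\in(\mathbb{Z}/q\mathbb{Z})^\times$ define $$C(q,a)=\lim_{x\to\infty}(\log x)^{1/\varphi(q)}\prod_{\substack{p\le x\\ p\equiv a\ (\mathrm{mod}\ q)}}\left(1-\frac1p\right),\qquad D(q,a)=\prod_{p\equiv a\ (\mathrm{mod}\ q)}\left(1-\frac1{p^2}\right).$$ The limit $C(q,a)$ exists and is positive by Mertens' theorem in arithmetic progressions: for each $a\in(\mathbb{Z}/q\mathbb{Z})^\times$ there is a constant $B(q,a)$ with $\sum_{p\le x,\ p\equiv a\ (\mathrm{mod}\ q)}\frac1p=\frac1{\varphi(q)}\log\log x+B(q,a)+o(1)$ as $x\to\infty$. *)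

theory Defs
  imports
    "HOL-Analysis.Analysis"
    "HOL-Number_Theory.Number_Theory"
    "HOL-Library.Landau_Symbols"
begin

text \<open>
  The units of \<open>\<int>/q\<int>\<close> (for \<open>q > 1\<close>) are represented by their canonical representatives,
  the elements of \<^term>\<open>totatives q\<close>; accordingly, the class of a prime \<open>p\<close> is
  \<^term>\<open>p mod q\<close>.
\<close>

text \<open>Only the values at odd integers matter; even integers are sent to \<open>0\<close>.\<close>

definition chi4 :: "int \<Rightarrow> int" where
  "chi4 n = (if [n = 1] (mod 4) then 1 else if [n = 3] (mod 4) then - 1 else 0)"

definition A_factor :: "nat \<Rightarrow> real" where
  "A_factor p = (real p - of_int (chi4 (int p))) / (real p + of_int (chi4 (int p)))"

definition odd_primes_upto :: "real \<Rightarrow> nat set" where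
  "odd_primes_upto x = {p. prime p \<and> odd p \<and> real p \<le> x}"

definition P_prod :: "nat \<Rightarrow> nat set \<Rightarrow> real \<Rightarrow> real" where
  "P_prod q S x = (\<Prod>p | p \<in> odd_primes_upto x \<and> p mod q \<in> S. A_factor p)"

definition mu_sum :: "nat set \<Rightarrow> int" where
  "mu_sum S = (\<Sum>a\<in>S. chi4 (int a))"

definition C_const :: "nat \<Rightarrow> nat \<Rightarrow> real" where
  "C_const q a = Lim at_top (\<lambda>x::real. ln x powr (1 / real (totient q)) *
      (\<Prod>p | p \<in> odd_primes_upto x \<and> [p = a] (mod q). 1 - 1 / real p))"

text \<open>The product over a set of primes is a product over \<open>\<nat>\<close> with trivial factors elsewhere.\<close>

definition D_const :: "nat \<Rightarrow> nat \<Rightarrow> real" where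
  "D_const q a =
      (\<Prod>p. if prime p \<and> odd p \<and> [p = a] (mod q) then 1 - 1 / (real p)\<^sup>2 else 1)"

text \<open>\<open>f(x) = g(x) (1 + o(1))\<close> as \<open>x \<rightarrow> \<infinity>\<close> is expressed by \<open>f \<sim>[at_top] g\<close>.\<close>

definition is_leading_const :: "nat \<Rightarrow> nat set \<Rightarrow> real \<Rightarrow> bool" where
  "is_leading_const q S K \<longleftrightarrow> K > 0 \<and>
      P_prod q S \<sim>[at_top]
        (\<lambda>x. K * ln x powr (- 2 * of_int (mu_sum S) / real (totient q)))"

definition K_const :: "nat \<Rightarrow> nat set \<Rightarrow> real" where
  "K_const q S = (THE K. is_leading_const q S K)"

end

theory Submission
  imports
    Defs
    "HOL-Computational_Algebra.Squarefree"
    "HOL-Real_Asymp.Real_Asymp"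
begin

text \<open>
  For an odd prime \<open>p\<close> with \<open>s = chi4 p\<close> the factor \<open>A(p)\<close> equals
  \<open>((1 - 1/p)\<^sup>2 / (1 - 1/p\<^sup>2))\<close> raised to the power \<open>s\<close>. As \<open>4\<close> divides \<open>q\<close>, the sign is
  constant on residue classes, so \<open>P_S(x)\<close> is a finite product over \<open>a \<in> S\<close> of powers of truncated
  products over one class (\<open>P_prod_eq\<close>). The products of \<open>1 - 1/p\<^sup>2\<close> converge absolutely to
  \<open>D(q,a) > 0\<close>. Everything therefore rests on Mertens' theorem in progressions modulo \<open>2 ^ m\<close>:
  the product of \<open>1 - 1/p\<close> over one class, times \<open>(ln x)\<close> to the power \<open>1/\<phi>(q)\<close>, has a
  positive limit (\<open>C_const_twopow\<close>).

  That theorem is proved here by real-variable methods, without complex analysis. Partial summation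
  against \<open>1 / ln n\<close> (Dirichlet's test) turns a mere bounded error into convergence, so it is enough
  to know that the sum of \<open>ln p / p\<close> over the primes \<open>p \<le> N\<close> with \<open>p \<equiv> a\<close> is
  \<open>ln N / \<phi>(q) + O(1)\<close> (\<open>mertens_primes_if_log\<close>). Prime powers contribute only \<open>O(1)\<close>, so \<open>ln p\<close>
  may be replaced by the von Mangoldt function, and orthogonality of characters reduces the claim to
  the sums of \<open>\<chi>(n) \<Lambda>(n) / n\<close>. For the principal character such a sum is
  \<open>ln N + O(1)\<close> by Chebyshev's and Mertens' classical argument with \<open>ln N!\<close> (\<open>mertens_mangoldt\<close>).
  For a nonprincipal \<open>\<chi>\<close> it is bounded as soon as \<open>L(1,\<chi>) \<noteq> 0\<close> (\<open>bounded_H\<close>).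

  The nonvanishing of \<open>L(1,\<chi>)\<close> has two cases. If \<open>\<chi>\<^sup>2\<close> is not principal, then a zero would
  make the sum of \<open>\<chi>(n) \<Lambda>(n) / n\<close> equal to \<open>- ln N + O(1)\<close>, which contradicts the inequality
  \<open>3 + 4 cos t + cos (2 t) \<ge> 0\<close> (\<open>L_nonzero_if_square_nonprincipal\<close>). If \<open>\<chi>\<^sup>2\<close> is principal,
  the special modulus helps: an odd number that is \<open>1\<close> modulo \<open>8\<close> is a square modulo \<open>2 ^ m\<close>, so \<open>\<chi>\<close> has period
  \<open>8\<close>, and the terms of the series, grouped in blocks of eight, are visibly positive
  (\<open>L_nonzero_twopow\<close>). The characters themselves are explicit, because every odd residue
  is uniquely a sign times a power of \<open>5\<close>.
\<close>

section \<open>Partial summation\<close>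

text \<open>
  Abel summation: after the sum is rewritten with the partial sums of \<open>a\<close>, the decrements of \<open>g\<close> are
  nonnegative and telescope to \<open>g m\<close>.
\<close>

lemma norm_sum_antimono_le:
  fixes a :: "nat \<Rightarrow> 'a::real_normed_vector" and g :: "nat \<Rightarrow> real"
  assumes anti: "\<And>k. k \<ge> m \<Longrightarrow> g (Suc k) \<le> g k" and nonneg: "\<And>k. k \<ge> m \<Longrightarrow> 0 \<le> g k"
    and bound: "\<And>n. norm (\<Sum>k=m..<n. a k) \<le> B"
  shows "norm (\<Sum>k=m..<n. g k *\<^sub>R a k) \<le> B * g m"
proof (cases "m \<le> n")
  case True
  define S where "S n = (\<Sum>k=m..<n. a k)" for n
  have "(\<Sum>k=m..<n. g k *\<^sub>R a k)
      = g n *\<^sub>R S n + (\<Sum>k=m..<n. (g k - g (Suc k)) *\<^sub>R S (Suc k))"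
    using True
    by (induction n rule: dec_induct) (simp_all add: S_def algebra_simps)
  also have "norm \<dots> \<le> g n * B + (\<Sum>k=m..<n. (g k - g (Suc k)) * B)"
    using True anti nonneg bound
    by (intro norm_triangle_mono sum_norm_le) (auto simp: S_def abs_of_nonneg simp del: sum.op_ivl_Suc intro!: mult_left_mono)
  also have "(\<Sum>k=m..<n. (g k - g (Suc k)) * B) = (g m - g n) * B"
    using sum_Suc_diff'[OF True, of "\<lambda>k. - g k"] by (simp add: sum_distrib_right[symmetric])
  finally show ?thesis
    by (simp add: algebra_simps)
next
  case False
  then show ?thesis
    using bound[of m] nonneg[of m] by simp
qed

lemma norm_sum_segment_le:
  fixes a :: "nat \<Rightarrow> 'a::real_normed_vector"
  assumes "\<And>n. norm (\<Sum>k<n. a k) \<le> B"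
  shows "norm (\<Sum>k=m..<n. a k) \<le> 2 * B"
proof (cases "m \<le> n")
  case True
  have "(\<Sum>k=m..<n. a k) = (\<Sum>k<n. a k) - (\<Sum>k<m. a k)"
    using sum_diff_nat_ivl[of 0 m n a] True by (simp add: lessThan_atLeast0)
  also have "norm \<dots> \<le> B + B"
    by (intro norm_triangle_le_diff add_mono assms)
  finally show ?thesis by simp
next
  case False
  then show ?thesis
    using assms[of 0] by simp
qed

text \<open>
  Monotonicity is required only from some index on, since the weights used below, such as
  \<open>1 / ln n\<close> and \<open>ln n / n\<close>, decrease only after the first few terms.
\<close>

lemma summable_dirichlet_test:
  fixes a :: "nat \<Rightarrow> 'a::banach" and g :: "nat \<Rightarrow> real"
  assumes anti: "\<And>k. k \<ge> m \<Longrightarrow> g (Suc k) \<le> g k" and lim: "g \<longlonglongrightarrow> 0"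
    and bound: "\<And>n. norm (\<Sum>k<n. a k) \<le> B"
  shows "summable (\<lambda>k. g k *\<^sub>R a k)"
  unfolding summable_Cauchy
proof (intro allI impI)
  fix e :: real assume "e > 0"
  have nonneg: "0 \<le> g k" if "k \<ge> m" for k
  proof (rule LIMSEQ_le_const2[OF lim])
    have "g n \<le> g k" if "n \<ge> k" for n
      using that \<open>k \<ge> m\<close> by (induction n rule: dec_induct) (auto intro: order.trans[OF anti])
    then show "\<exists>N. \<forall>n\<ge>N. g n \<le> g k" by blast
  qed
  have "(\<lambda>k. 2 * B * g k) \<longlonglongrightarrow> 2 * B * 0"
    by (intro tendsto_intros lim)
  then have "eventually (\<lambda>k. 2 * B * g k < e) sequentially"
    using \<open>e > 0\<close> by (intro order_tendstoD) auto
  then obtain N where N: "\<And>k. k \<ge> N \<Longrightarrow> 2 * B * g k < e"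
    by (auto simp: eventually_sequentially)
  show "\<exists>N. \<forall>k\<ge>N. \<forall>n. norm (\<Sum>k=k..<n. g k *\<^sub>R a k) < e"
  proof (intro exI allI impI)
    fix k n assume k: "k \<ge> max m N"
    have "norm (\<Sum>k=k..<n. g k *\<^sub>R a k) \<le> 2 * B * g k"
      using k by (intro norm_sum_antimono_le anti nonneg norm_sum_segment_le bound) auto
    also have "\<dots> < e" using N k by simp
    finally show "norm (\<Sum>k=k..<n. g k *\<^sub>R a k) < e" .
  qed
qed

section \<open>Chebyshev's bound and Mertens' first theorem\<close>

text \<open>
  Both sides range over the pairs \<open>(d, e)\<close> with \<open>d * e \<le> N\<close>. This is the rearrangement by which sums of
  Dirichlet convolutions are evaluated throughout.
\<close>

lemma sum_divisors_swap:
  fixes F :: "nat \<Rightarrow> nat \<Rightarrow> 'a::comm_monoid_add"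
  shows "(\<Sum>k=1..N. \<Sum>d | d dvd k. F d (k div d)) = (\<Sum>d=1..N. \<Sum>e=1..N div d. F d e)"
proof -
  have "(\<Sum>k=1..N. \<Sum>d | d dvd k. F d (k div d))
      = (\<Sum>(k, d) \<in> (SIGMA k:{1..N}. {d. d dvd k}). F d (k div d))"
    by (rule sum.Sigma) auto
  also have "\<dots> = (\<Sum>(d, e) \<in> (SIGMA d:{1..N}. {1..N div d}). F d e)"
    by (rule sum.reindex_bij_witness[where i = "\<lambda>(d, e). (d * e, d)" and j = "\<lambda>(k, d). (d, k div d)"])
       (auto simp: div_le_mono less_eq_div_iff_mult_less_eq mult.commute Suc_le_eq
         dest: dvd_imp_le intro: dvd_pos_nat order.trans[OF dvd_imp_le])
  also have "\<dots> = (\<Sum>d=1..N. \<Sum>e=1..N div d. F d e)"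
    by (rule sum.Sigma[symmetric]) auto
  finally show ?thesis .
qed

lemma ln_fact_eq_sum: "ln (fact N) = (\<Sum>n=1..N. ln (real n))"
  by (induction N) (simp_all add: ln_mult)

text \<open>
  Summing \<open>ln = \<Lambda> * 1\<close> over \<open>n \<le> N\<close>. The left-hand side is elementary, and this is what gives
  information about primes.
\<close>

lemma ln_fact_conv_mangoldt:
  "ln (fact N) = (\<Sum>d=1..N. mangoldt d * real (N div d))"
proof -
  have "ln (fact N) = (\<Sum>n=1..N. \<Sum>d | d dvd n. mangoldt d :: real)"
    unfolding ln_fact_eq_sum by (intro sum.cong refl) (simp add: mangoldt_sum)
  also have "\<dots> = (\<Sum>d=1..N. \<Sum>e=1..N div d. mangoldt d)"
    using sum_divisors_swap[of "\<lambda>d e. mangoldt d :: real" N] by simp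
  finally show ?thesis by (simp add: mult.commute)
qed

text \<open>The weak form of Stirling's formula that comes from one term of the series of \<open>exp N\<close>.\<close>

lemma ln_fact_ge: "real N * ln (real N) - real N \<le> ln (fact N)"
proof (cases "N = 0")
  case False
  have "real N ^ N / fact N \<le> exp (real N)" 
  proof -
    have "(\<Sum>n\<in>{N}. real N ^ n / fact n) \<le> (\<Sum>n. real N ^ n / fact n)"
      using summable_exp[of "real N"] by (intro sum_le_suminf) (auto simp: field_simps)
    then show ?thesis by (simp add: exp_def scaleR_conv_of_real field_simps)
  qed
  then have "ln (real N ^ N / fact N) \<le> real N"
    using False by (metis exp_gt_zero ln_exp ln_le_cancel_iff divide_pos_pos fact_gt_zero of_nat_0_less_iff neq0_conv zero_less_power)
  then show ?thesis
    using False by (simp add: ln_div ln_realpow)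
qed auto

lemma ln_fact_le: "ln (fact N) \<le> real N * ln (real N)"
proof (cases "N = 0")
  case False
  have "ln (fact N) \<le> ln (real N ^ N)"
    using False fact_le_power[of N] by simp
  then show ?thesis
    using False by (simp add: ln_realpow)
qed auto

definition psi :: "nat \<Rightarrow> real" where
  "psi N = (\<Sum>n=1..N. mangoldt n)"

lemma psi_mono_Suc: "psi (Suc N) = psi N + mangoldt (Suc N)"
  by (simp add: psi_def)

text \<open>
  Chebyshev's argument: \<open>\<lfloor>2N/d\<rfloor> - 2\<lfloor>N/d\<rfloor>\<close> is nonnegative and is \<open>1\<close> for \<open>N < d \<le> 2N\<close>, so the
  increment of \<open>\<psi>\<close> is at most the logarithm of the central binomial coefficient.
\<close>

lemma psi_double_le: "psi (2 * N) - psi N \<le> 2 * real N * ln 2"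
proof -
  have "psi (2 * N) - psi N = (\<Sum>d=1..2 * N. mangoldt d * (if d > N then 1 else 0))"
  proof -
    have "{1..2 * N} = {1..N} \<union> {N + 1..2 * N}" by auto
    then have "psi (2 * N) = psi N + (\<Sum>d=N + 1..2 * N. mangoldt d)"
      unfolding psi_def by (simp only:) (subst sum.union_disjoint, auto)
    also have "(\<Sum>d=N + 1..2 * N. mangoldt d) = (\<Sum>d=1..2 * N. mangoldt d * (if d > N then 1 else 0 :: real))"
      by (intro sum.mono_neutral_cong_left) auto
    finally show ?thesis by simp
  qed
  also have "\<dots> \<le> (\<Sum>d=1..2 * N. mangoldt d * (real (2 * N div d) - 2 * real (N div d)))"
  proof (intro sum_mono mult_left_mono mangoldt_nonneg)
    fix d assume d: "d \<in> {1..2 * N}"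
    have "2 * (N div d) \<le> 2 * N div d"
      using d by (simp add: less_eq_div_iff_mult_less_eq)
    moreover have "1 \<le> 2 * N div d" "N div d = 0" if "d > N"
      using d that by (auto simp: div_greater_zero_iff Suc_le_eq)
    ultimately show "(if d > N then 1 else 0) \<le> real (2 * N div d) - 2 * real (N div d)"
      by auto
  qed
  also have "\<dots> = ln (fact (2 * N)) - 2 * (\<Sum>d=1..2 * N. mangoldt d * real (N div d))"
    unfolding ln_fact_conv_mangoldt by (simp add: algebra_simps sum_subtractf sum_distrib_left)
  also have "(\<Sum>d=1..2 * N. mangoldt d * real (N div d)) = ln (fact N)"
    unfolding ln_fact_conv_mangoldt by (intro sum.mono_neutral_right) auto
  also have "ln (fact (2 * N)) - 2 * ln (fact N) = ln (real (2 * N choose N))"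
    by (simp add: binomial_fact ln_div ln_mult)
  also have "\<dots> \<le> ln (2 ^ (2 * N))"
    by (subst ln_le_cancel_iff) (auto simp: binomial_le_pow2 simp flip: of_nat_le_iff)
  finally show ?thesis by (simp add: ln_realpow)
qed

lemma psi_le: "psi N \<le> 4 * real N"
proof (induction N rule: less_induct)
  case (less N)
  show ?case
  proof (cases "N = 0")
    case False
    define K where "K = N div 2"
    have K: "psi (2 * K) \<le> 6 * real K"
    proof -
      have "psi K \<le> 4 * real K" using False by (intro less) (auto simp: K_def)
      then show ?thesis
        using psi_double_le[of K] ln_2_less_1 mult_left_mono[of "ln 2" 1 "2 * real K"] by simp
    qed
    show ?thesis
    proof (cases "even N")
      case True
      then show ?thesis using K by (auto simp: K_def)
    next
      case odd: False
      then have N: "N = Suc (2 * K)" by (auto simp: K_def elim!: oddE)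
      have "mangoldt N \<le> ln (real N)" using False by (intro mangoldt_le) auto
      also have "\<dots> \<le> real N - 1" using False by (intro ln_le_minus_one) auto
      finally show ?thesis using K by (simp add: N psi_mono_Suc)
    qed
  qed (simp add: psi_def)
qed

text \<open>
  Replacing \<open>\<lfloor>N/d\<rfloor>\<close> by \<open>N/d\<close> in the formula for \<open>ln N!\<close> costs at most \<open>\<psi>(N) = O(N)\<close>; the claim follows
  on division by \<open>N\<close>.
\<close>

lemma mertens_mangoldt:
  assumes "N \<ge> 1"
  shows "\<bar>(\<Sum>n=1..N. mangoldt n / real n) - ln (real N)\<bar> \<le> 4"
proof -
  define s where "s = (\<Sum>n=1..N. mangoldt n / real n)"
  have "ln (fact N) \<le> real N * s"
    unfolding ln_fact_conv_mangoldt s_def sum_distrib_left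
  proof (intro sum_mono)
    fix d assume "d \<in> {1..N}"
    have "mangoldt d * real (N div d) \<le> mangoldt d * (real N / real d)"
      by (intro mult_left_mono mangoldt_nonneg of_nat_div_le_of_nat)
    then show "mangoldt d * real (N div d) \<le> real N * (mangoldt d / real d)" by (simp add: mult.commute)
  qed
  then have "real N * (ln (real N) - 1) \<le> real N * s"
    using ln_fact_ge[of N] by (simp add: algebra_simps)
  then have 1: "ln (real N) - 1 \<le> s" using assms by simp
  have "real N * s - psi N \<le> ln (fact N)"
    unfolding ln_fact_conv_mangoldt s_def sum_distrib_left psi_def sum_subtractf[symmetric]
  proof (intro sum_mono)
    fix d assume d: "d \<in> {1..N}"
    have "real N / real d - 1 \<le> real (N div d)"
      using floor_divide_of_nat_eq[of N d, where 'a = real] by linarith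
    then have "mangoldt d * (real N / real d - 1) \<le> mangoldt d * real (N div d)"
      by (intro mult_left_mono mangoldt_nonneg)
    then show "real N * (mangoldt d / real d) - mangoldt d \<le> mangoldt d * real (N div d)"
      by (simp add: algebra_simps)
  qed
  then have "real N * s \<le> real N * (ln (real N) + 4)"
    using psi_le[of N] ln_fact_le[of N] by (simp add: algebra_simps)
  then have "s \<le> ln (real N) + 4" using assms by simp
  with 1 show ?thesis by (simp add: s_def abs_le_iff)
qed

section \<open>The Moebius function\<close>

definition moebius :: "nat \<Rightarrow> real" where
  "moebius n = (if squarefree n then (- 1) ^ card (prime_factors n) else 0)"

lemma abs_moebius_le_1: "\<bar>moebius n\<bar> \<le> 1"
  by (simp add: moebius_def power_abs)

lemma moebius_prime_mult:
  assumes "prime p" "\<not> p dvd d" "d > 0"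
  shows "moebius (d * p) = - moebius d"
proof -
  have cop: "coprime d p"
    using assms coprime_commute prime_imp_coprime by blast
  have "prime_factors (d * p) = insert p (prime_factors d)"
    using assms by (subst prime_factors_product) (auto simp: prime_factorization_prime)
  moreover have "p \<notin> prime_factors d" using assms by auto
  moreover have "squarefree (d * p) \<longleftrightarrow> squarefree d"
    using squarefree_mult_coprime[OF cop] squarefree_multD(1) assms squarefree_prime by metis
  ultimately show ?thesis
    by (simp add: moebius_def)
qed

text \<open>
  For a prime \<open>p\<close> dividing \<open>n\<close>, the squarefree divisors come in pairs \<open>d\<close>, \<open>d * p\<close> with opposite signs.
\<close>

lemma sum_moebius_divisors:
  assumes "n > 0"
  shows "(\<Sum>d | d dvd n. moebius d) = (if n = 1 then 1 else 0)"
proof (cases "n = 1")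
  case False
  then obtain p where p: "prime p" "p dvd n"
    using prime_factor_nat by blast
  define A where "A = {d. d dvd n \<and> squarefree d \<and> \<not> p dvd d}"
  define B where "B = {d. d dvd n \<and> squarefree d \<and> p dvd d}"
  have fin: "finite A" "finite B"
    using assms by (auto simp: A_def B_def)
  have "(\<Sum>d | d dvd n. moebius d) = (\<Sum>d\<in>A \<union> B. moebius d)"
    using assms by (intro sum.mono_neutral_right) (auto simp: A_def B_def moebius_def)
  also have "\<dots> = (\<Sum>d\<in>A. moebius d) + (\<Sum>d\<in>B. moebius d)"
    using fin by (intro sum.union_disjoint) (auto simp: A_def B_def)
  also have "(\<Sum>d\<in>B. moebius d) = (\<Sum>d\<in>A. moebius (d * p))"
  proof (rule sum.reindex_bij_witness[where i = "\<lambda>d. d * p" and j = "\<lambda>d. d div p"])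
    fix d assume d: "d \<in> B"
    then have "p dvd d" by (simp add: B_def)
    then obtain e where e: "d = e * p" by (metis dvdE mult.commute)
    have "\<not> p dvd e"
    proof
      assume "p dvd e"
      then have "p\<^sup>2 dvd d" by (auto simp: e power2_eq_square)
      then show False using d p squarefreeD[of d p] by (auto simp: B_def)
    qed
    moreover have "e dvd n" "squarefree e"
      using d squarefree_multD(1)[of e p] by (auto simp: B_def e dest: dvd_mult_left)
    ultimately show "d div p \<in> A" "d div p * p = d" "moebius (d div p * p) = moebius d"
      using p by (auto simp: A_def e)
  next
    fix d assume d: "d \<in> A"
    then have "coprime d p"
      using p coprime_commute prime_imp_coprime by (auto simp: A_def)
    then show "d * p \<in> B"
      using d p by (auto simp: A_def B_def squarefree_mult_coprime squarefree_prime intro: divides_mult)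
    show "d * p div p = d" using p by auto
  qed
  also have "\<dots> = (\<Sum>d\<in>A. - moebius d)"
    using assms p by (intro sum.cong refl moebius_prime_mult) (auto simp: A_def intro: Nat.gr0I)
  finally show ?thesis using False by (simp add: sum_negf)
qed (simp add: moebius_def)

lemma divisor_pairs:
  assumes "d dvd n" "e dvd n div d" "n > (0::nat)"
  shows "e dvd n" "d dvd n div e"
proof -
  obtain k where "n = d * (e * k)"
    using assms by (auto elim!: dvdE)
  then show "e dvd n" "d dvd n div e"
    using assms(3) by auto
qed

text \<open>
  This is \<open>\<Lambda> = \<mu> * ln\<close> with \<open>n\<close> replaced by a free parameter \<open>N\<close> under the logarithm, which changes
  the value only at \<open>n = 1\<close>. The surplus \<open>ln N\<close> there is what makes a vanishing \<open>L\<close>-value visible.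
\<close>

lemma sum_moebius_ln_divisors:
  assumes "n > 0" "N > 0"
  shows "(\<Sum>d | d dvd n. moebius d * ln (real N / real d)) = mangoldt n + (if n = 1 then ln (real N) else 0)"
proof -
  have fin: "finite {d. d dvd n}" "\<And>d. d dvd n \<Longrightarrow> finite {e. e dvd n div d}"
    using assms by (auto simp: dvd_div_eq_0_iff)
  have swap: "(\<Sum>d | d dvd n. moebius d * ln (real (n div d))) = mangoldt n"
  proof -
    have "(\<Sum>d | d dvd n. moebius d * ln (real (n div d)))
        = (\<Sum>d | d dvd n. \<Sum>e | e dvd n div d. moebius d * mangoldt e)"
    proof (intro sum.cong refl)
      fix d assume "d \<in> {d. d dvd n}"
      then have "n div d \<noteq> 0" using assms by (auto simp: dvd_div_eq_0_iff)
      from mangoldt_sum[OF this, where 'a = real]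
      show "moebius d * ln (real (n div d)) = (\<Sum>e | e dvd n div d. moebius d * mangoldt e)"
        by (simp only: sum_distrib_left [symmetric] of_real_eq_id id_apply)
    qed
    also have "\<dots> = (\<Sum>(d, e) \<in> (SIGMA d:{d. d dvd n}. {e. e dvd n div d}). moebius d * mangoldt e)"
      using fin by (intro sum.Sigma) simp_all
    also have "\<dots> = (\<Sum>(e, d) \<in> (SIGMA e:{e. e dvd n}. {d. d dvd n div e}). moebius d * mangoldt e)"
    proof (rule sum.reindex_bij_witness[where i = "\<lambda>(e, d). (d, e)" and j = "\<lambda>(d, e). (e, d)"])
      show "(case x of (d, e) \<Rightarrow> (e, d)) \<in> (SIGMA e:{e. e dvd n}. {d. d dvd n div e})"
        if "x \<in> (SIGMA d:{d. d dvd n}. {e. e dvd n div d})" for x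
        using divisor_pairs[OF _ _ assms(1), of "fst x" "snd x"] that by (cases x) simp
      show "(case x of (e, d) \<Rightarrow> (d, e)) \<in> (SIGMA d:{d. d dvd n}. {e. e dvd n div d})"
        if "x \<in> (SIGMA e:{e. e dvd n}. {d. d dvd n div e})" for x
        using divisor_pairs[OF _ _ assms(1), of "fst x" "snd x"] that by (cases x) simp
    qed auto
    also have "\<dots> = (\<Sum>e | e dvd n. \<Sum>d | d dvd n div e. moebius d * mangoldt e)"
      using fin by (intro sum.Sigma[symmetric]) simp_all
    also have "\<dots> = (\<Sum>e | e dvd n. if e = n then mangoldt e else 0)"
    proof (intro sum.cong refl)
      fix e assume e: "e \<in> {e. e dvd n}"
      then obtain k where k: "n = e * k" by (auto elim: dvdE)
      then have "e > 0" "k > 0" using assms by auto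
      then show "(\<Sum>d | d dvd n div e. moebius d * mangoldt e) = (if e = n then mangoldt e else 0)"
        using sum_moebius_divisors[of k] k by (simp flip: sum_distrib_right)
    qed
    also have "\<dots> = mangoldt n"
      using fin by (subst sum.delta) auto
    finally show ?thesis .
  qed
  have "(\<Sum>d | d dvd n. moebius d * ln (real N / real d))
      = (\<Sum>d | d dvd n. moebius d * ln (real (n div d)) + moebius d * ln (real N / real n))"
  proof (intro sum.cong refl)
    fix d assume d: "d \<in> {d. d dvd n}"
    then have "d > 0" using assms by (auto intro: Nat.gr0I)
    moreover from d have "real (n div d) = real n / real d"
      by (simp add: real_of_nat_div)
    ultimately show "moebius d * ln (real N / real d)
        = moebius d * ln (real (n div d)) + moebius d * ln (real N / real n)"
      using assms by (simp add: ln_div algebra_simps del: of_nat_div)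
  qed
  also have "\<dots> = mangoldt n + (\<Sum>d | d dvd n. moebius d) * ln (real N / real n)"
    by (simp only: sum.distrib swap sum_distrib_right)
  finally show ?thesis
    unfolding sum_moebius_divisors[OF assms(1)] by auto
qed

section \<open>Dirichlet characters and their values at 1\<close>

locale dirichlet_character =
  fixes q :: nat and chi :: "nat \<Rightarrow> complex"
  assumes q_pos: "q > 0"
    and one [simp]: "chi (Suc 0) = 1"
    and mult: "chi (a * b) = chi a * chi b"
    and period: "chi (a + q) = chi a"
    and not_coprime: "\<not> coprime a q \<Longrightarrow> chi a = 0"
begin

lemma eq_mod: "chi (a mod q) = chi a"
proof -
  have "chi (b + k * q) = chi b" for b k
  proof (induction k)
    case (Suc k)
    then show ?case using period[of "b + k * q"] by (simp add: ac_simps)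
  qed simp
  from this[of "a mod q" "a div q"] show ?thesis by (simp add: add.commute)
qed

lemma cong_imp_eq: "[a = b] (mod q) \<Longrightarrow> chi a = chi b"
  by (metis cong_def eq_mod)

lemma power: "chi (a ^ k) = chi a ^ k"
  by (induction k) (simp_all add: mult)

text \<open>By Euler's theorem the values at units are roots of unity.\<close>

lemma norm_coprime:
  assumes "coprime a q"
  shows "norm (chi a) = 1"
proof -
  have "chi a ^ totient q = 1"
    using cong_imp_eq[OF euler_theorem[OF assms]] by (simp add: power)
  then have "norm (chi a) ^ totient q = 1" by (simp flip: norm_power)
  then show ?thesis
    using q_pos power_eq_imp_eq_base[of "norm (chi a)" "totient q" 1] by simp
qed

lemma norm_le_1: "norm (chi a) \<le> 1"
  by (cases "coprime a q") (simp_all add: norm_coprime not_coprime)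

text \<open>
  The partial sums of \<open>- L'/L\<close> at \<open>1\<close>. Whether they stay bounded decides the distribution of primes
  in residue classes.
\<close>

definition H :: "nat \<Rightarrow> complex" where
  "H N = (\<Sum>n=1..N. chi n / of_nat n * mangoldt n)"

lemma twisted_sum_divisors_swap:
  "(\<Sum>k=1..N. chi k / of_nat k * (\<Sum>d | d dvd k. u d))
    = (\<Sum>d=1..N. chi d / of_nat d * u d * (\<Sum>e=1..N div d. chi e / of_nat e))"
proof -
  have "(\<Sum>k=1..N. chi k / of_nat k * (\<Sum>d | d dvd k. u d))
      = (\<Sum>k=1..N. \<Sum>d | d dvd k. chi d / of_nat d * u d * (chi (k div d) / of_nat (k div d)))"
    unfolding sum_distrib_left
    by (intro sum.cong refl) (auto elim!: dvdE simp: mult)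
  also have "\<dots> = (\<Sum>d=1..N. \<Sum>e=1..N div d. chi d / of_nat d * u d * (chi e / of_nat e))"
    by (rule sum_divisors_swap)
  finally show ?thesis by (simp add: sum_distrib_left)
qed

end

locale nonprincipal_character = dirichlet_character +
  assumes nonprincipal: "\<exists>a. coprime a q \<and> chi a \<noteq> 1"
begin

text \<open>Multiplication by a unit \<open>a\<close> permutes the residues and multiplies the sum by \<open>chi a \<noteq> 1\<close>.\<close>

lemma sum_period: "(\<Sum>k<q. chi k) = 0"
proof -
  obtain a where a: "coprime a q" "chi a \<noteq> 1" using nonprincipal by blast
  have inj: "inj_on (\<lambda>k. a * k mod q) {..<q}"
  proof (rule inj_onI)
    fix x y assume "x \<in> {..<q}" "y \<in> {..<q}" "a * x mod q = a * y mod q"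
    then show "x = y"
      using a cong_mult_lcancel_nat[of a q x y] by (auto simp: cong_def)
  qed
  have "bij_betw (\<lambda>k. a * k mod q) {..<q} {..<q}"
    unfolding bij_betw_def using endo_inj_surj[OF _ _ inj] inj q_pos by (simp add: image_subset_iff)
  from sum.reindex_bij_betw[OF this, of chi]
  have "chi a * (\<Sum>k<q. chi k) = (\<Sum>k<q. chi k)"
    by (simp add: eq_mod mult sum_distrib_left)
  then show ?thesis using a by simp
qed

lemma norm_sum_le: "norm (\<Sum>k<n. chi k) \<le> real q"
proof (induction n rule: less_induct)
  case (less n)
  show ?case
  proof (cases "n < q")
    case True
    have "norm (\<Sum>k<n. chi k) \<le> (\<Sum>k<n. 1)"
      by (intro sum_norm_le norm_le_1)
    then show ?thesis using True by simp
  next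
    case False
    \<comment> \<open>Removing a full period does not change the sum, so fewer than \<open>q\<close> terms matter.\<close>
    have shift: "(\<Sum>k<j + q. chi k) = (\<Sum>k<j. chi k)" for j
      by (induction j) (simp_all add: sum_period period)
    from shift[of "n - q"] less[of "n - q"] False q_pos show ?thesis by simp
  qed
qed

definition L :: complex where
  "L = (\<Sum>n. chi n / of_nat n)"

lemma summable_L: "summable (\<lambda>n. chi n / of_nat n)"
proof -
  have "summable (\<lambda>n. (1 / real n) *\<^sub>R chi n)"
    by (rule summable_dirichlet_test[of 1, OF _ _ norm_sum_le])
       (auto simp: field_simps intro: lim_1_over_n)
  then show ?thesis by (simp add: scaleR_conv_of_real field_simps)
qed

text \<open>
  The error \<open>O(1/N)\<close> is as strong as needed: inserted at \<open>N/d\<close> and weighted by \<open>1/d\<close>, it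
  contributes \<open>O(1/N)\<close> for each \<open>d\<close>, which compensates for the number of terms.
\<close>

lemma L_tail: "norm ((\<Sum>n=1..N. chi n / of_nat n) - L) \<le> 2 * real q / real (N + 1)"
proof -
  let ?S = "\<lambda>N. \<Sum>n=1..N. chi n / of_nat n"
  have S: "?S N = (\<Sum>n<Suc N. chi n / of_nat n)" for N
    by (intro sum.mono_neutral_left) (auto simp: Suc_le_eq)
  have "(\<lambda>M. (\<Sum>n<M. chi n / of_nat n)) \<longlonglongrightarrow> L"
    unfolding L_def by (rule summable_LIMSEQ[OF summable_L])
  then have lim: "(\<lambda>M. norm (?S N - (\<Sum>n<M. chi n / of_nat n))) \<longlonglongrightarrow> norm (?S N - L)"
    by (intro tendsto_intros)
  show ?thesis
  proof (rule LIMSEQ_le_const2[OF lim], intro exI allI impI)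
    fix M assume M: "M \<ge> Suc N"
    have "norm (\<Sum>n=Suc N..<M. (1 / real n) *\<^sub>R chi n) \<le> (2 * real q) * (1 / real (Suc N))"
      by (intro norm_sum_antimono_le norm_sum_segment_le norm_sum_le) (auto simp: field_simps)
    moreover have "(\<Sum>n<M. chi n / of_nat n) - ?S N = (\<Sum>n=Suc N..<M. (1 / real n) *\<^sub>R chi n)"
      unfolding S using M sum_diff_nat_ivl[of 0 "Suc N" M "\<lambda>n. chi n / of_nat n"]
      by (simp add: lessThan_atLeast0 scaleR_conv_of_real)
    ultimately show "norm (?S N - (\<Sum>n<M. chi n / of_nat n)) \<le> 2 * real q / real (N + 1)"
      by (subst norm_minus_commute) simp
  qed
qed

lemma bounded_log_sum: "\<exists>C. \<forall>N. norm (\<Sum>n=1..N. chi n / of_nat n * of_real (ln (real n))) \<le> C"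
proof -
  have "summable (\<lambda>n. (ln (real n) / real n) *\<^sub>R chi n)"
  proof (rule summable_dirichlet_test[of 3, OF _ _ norm_sum_le])
    fix k :: nat assume "k \<ge> 3"
    then have "exp 1 \<le> real k" using exp_le by linarith
    then show "ln (real (Suc k)) / real (Suc k) \<le> ln (real k) / real k"
      by (intro ln_x_over_x_mono) auto
  qed (rule lim_ln_over_n)
  from summable_imp_sums_bounded[OF this]
  obtain C where C: "\<And>N. norm (\<Sum>n<N. (ln (real n) / real n) *\<^sub>R chi n) \<le> C"
    by (auto simp: bounded_iff)
  have "(\<Sum>n=1..N. chi n / of_nat n * of_real (ln (real n)))
      = (\<Sum>n<Suc N. (ln (real n) / real n) *\<^sub>R chi n)" for N
    by (intro sum.mono_neutral_cong_left) (auto simp: Suc_le_eq scaleR_conv_of_real)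
  with C show ?thesis by metis
qed

text \<open>
  Evaluate the sum of \<open>chi n * ln n / n\<close>, which is bounded since its series converges, by
  \<open>ln = \<Lambda> * 1\<close>. The inner sum over the cofactor is \<open>L + O(d/N)\<close>; the term \<open>L\<close> yields \<open>L * H N\<close>, and the
  errors add up to \<open>O(\<psi>(N)/N) = O(1)\<close>.
\<close>

lemma bounded_L_mult_H: "\<exists>C. \<forall>N. norm (L * H N) \<le> C"
proof -
  obtain C where C: "\<And>N. norm (\<Sum>n=1..N. chi n / of_nat n * of_real (ln (real n))) \<le> C"
    using bounded_log_sum by blast
  have "norm (L * H N) \<le> C + 8 * real q" if "N > 0" for N
  proof -
    let ?S = "\<lambda>N. \<Sum>n=1..N. chi n / of_nat n"
    have "(\<Sum>n=1..N. chi n / of_nat n * of_real (ln (real n)))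
        = (\<Sum>n=1..N. chi n / of_nat n * (\<Sum>d | d dvd n. mangoldt d))"
      by (intro sum.cong refl) (simp add: mangoldt_sum)
    also have "\<dots> = (\<Sum>d=1..N. chi d / of_nat d * mangoldt d * ?S (N div d))"
      by (rule twisted_sum_divisors_swap)
    also have "\<dots> = L * H N + (\<Sum>d=1..N. chi d / of_nat d * mangoldt d * (?S (N div d) - L))"
      by (simp add: H_def algebra_simps sum_subtractf sum_distrib_left sum.distrib)
    finally have eq: "L * H N = (\<Sum>n=1..N. chi n / of_nat n * of_real (ln (real n)))
      - (\<Sum>d=1..N. chi d / of_nat d * mangoldt d * (?S (N div d) - L))" by simp
    have "norm (\<Sum>d=1..N. chi d / of_nat d * mangoldt d * (?S (N div d) - L))
        \<le> (\<Sum>d=1..N. 2 * real q / real N * mangoldt d)"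
    proof (intro sum_norm_le)
      fix d assume d: "d \<in> {1..N}"
      have "norm (?S (N div d) - L) \<le> 2 * real q / real (N div d + 1)"
        by (rule L_tail)
      also have "\<dots> \<le> 2 * real q / (real N / real d)"
        using d that floor_divide_of_nat_eq[of N d, where 'a = real]
        by (intro divide_left_mono) (auto, linarith)
      finally have "norm (chi d) * (mangoldt d / real d) * norm (?S (N div d) - L)
          \<le> 1 * (mangoldt d / real d) * (2 * real q / (real N / real d))"
        by (intro mult_mono norm_le_1 order.refl) (auto simp: mangoldt_nonneg)
      also have "\<dots> = 2 * real q / real N * mangoldt d" using d by simp
      finally show "norm (chi d / of_nat d * mangoldt d * (?S (N div d) - L))
          \<le> 2 * real q / real N * mangoldt d"
        by (simp add: norm_mult norm_divide mult_ac)
    qed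
    also have "\<dots> = 2 * real q / real N * psi N"
      by (simp add: psi_def sum_distrib_left)
    also have "\<dots> \<le> 2 * real q / real N * (4 * real N)"
      by (intro mult_left_mono psi_le) auto
    also have "\<dots> = 8 * real q" using that by simp
    finally show ?thesis
      unfolding eq using C by (intro norm_triangle_le_diff add_mono) auto
  qed
  moreover have "norm (L * H 0) \<le> C + 8 * real q"
    using C[of 0] by (simp add: H_def)
  ultimately show ?thesis by (metis neq0_conv)
qed

text \<open>
  If \<open>L = 0\<close>, the previous identity says nothing about \<open>H\<close>, so the Moebius form is used instead: the inner
  sums are then \<open>O(d/N)\<close> themselves, and \<open>\<Sum> ln (N/d) \<le> N\<close> by the lower bound for \<open>ln N!\<close>. So a zero
  at \<open>1\<close> forces \<open>H N\<close> to behave like \<open>- ln N\<close>.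
\<close>

lemma H_if_L_eq_0:
  assumes "L = 0" "N > 0"
  shows "norm (H N + of_real (ln (real N))) \<le> 2 * real q"
proof -
  let ?S = "\<lambda>N. \<Sum>n=1..N. chi n / of_nat n"
  have "H N + of_real (ln (real N))
      = (\<Sum>n=1..N. chi n / of_nat n * mangoldt n + (if n = 1 then of_real (ln (real N)) else 0))"
    using assms by (simp add: H_def sum.distrib)
  also have "\<dots> = (\<Sum>n=1..N. chi n / of_nat n
        * of_real (mangoldt n + (if n = 1 then ln (real N) else 0)))"
    by (intro sum.cong refl) auto
  also have "\<dots> = (\<Sum>n=1..N. chi n / of_nat n
        * (\<Sum>d | d dvd n. of_real (moebius d * ln (real N / real d))))"
    using assms by (intro sum.cong refl) (subst sum_moebius_ln_divisors [symmetric], auto)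
  also have "\<dots> = (\<Sum>d=1..N. chi d / of_nat d * of_real (moebius d * ln (real N / real d)) * ?S (N div d))"
    by (rule twisted_sum_divisors_swap)
  also have "norm \<dots> \<le> (\<Sum>d=1..N. 2 * real q / real N * ln (real N / real d))"
  proof (intro sum_norm_le)
    fix d assume d: "d \<in> {1..N}"
    have ln: "ln (real N / real d) \<ge> 0" using d by simp
    have "norm (?S (N div d)) \<le> 2 * real q / real (N div d + 1)"
      using L_tail[of "N div d"] assms by simp
    also have "\<dots> \<le> 2 * real q / (real N / real d)"
      using d assms floor_divide_of_nat_eq[of N d, where 'a = real]
      by (intro divide_left_mono) (auto, linarith)
    finally have "norm (chi d) * \<bar>moebius d\<bar> * (ln (real N / real d) / real d) * norm (?S (N div d))
        \<le> 1 * 1 * (ln (real N / real d) / real d) * (2 * real q / (real N / real d))"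
      using ln by (intro mult_mono norm_le_1 abs_moebius_le_1 order.refl) auto
    also have "\<dots> = 2 * real q / real N * ln (real N / real d)" using d by simp
    finally show "norm (chi d / of_nat d * of_real (moebius d * ln (real N / real d)) * ?S (N div d))
        \<le> 2 * real q / real N * ln (real N / real d)"
      using ln by (simp add: norm_mult norm_divide abs_mult mult_ac)
  qed
  also have "\<dots> = 2 * real q / real N * (\<Sum>d=1..N. ln (real N / real d))"
    by (simp only: sum_distrib_left)
  also have "(\<Sum>d=1..N. ln (real N / real d)) = (\<Sum>d=1..N. ln (real N) - ln (real d))"
    using assms by (intro sum.cong refl) (auto simp: ln_div)
  also have "\<dots> = real N * ln (real N) - ln (fact N)"
    unfolding sum_subtractf ln_fact_eq_sum by simp
  also have "2 * real q / real N * (real N * ln (real N) - ln (fact N)) \<le> 2 * real q / real N * real N"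
    using ln_fact_ge[of N] by (intro mult_left_mono) auto
  finally show ?thesis using assms by simp
qed

lemma bounded_H: "L \<noteq> 0 \<Longrightarrow> \<exists>C. \<forall>N. norm (H N) \<le> C"
proof -
  assume "L \<noteq> 0"
  obtain C where "\<And>N. norm (L * H N) \<le> C" using bounded_L_mult_H by blast
  then have "norm (H N) \<le> C / norm L" for N
    using \<open>L \<noteq> 0\<close> by (simp add: norm_mult field_simps)
  then show ?thesis by blast
qed

text \<open>
  This holds whether or not \<open>L\<close> vanishes, so it can be applied to the square of a character, whose
  \<open>L\<close>-value is not known to be nonzero.
\<close>

lemma Re_H_bounded_above: "\<exists>C. \<forall>N. Re (H N) \<le> C"
proof (cases "L = 0")
  case True
  have "Re (H N) \<le> 2 * real q" for N
  proof (cases "N = 0")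
    case False
    have "Re (H N + of_real (ln (real N))) \<le> 2 * real q"
      using H_if_L_eq_0[OF True, of N] False complex_Re_le_cmod order.trans by blast
    moreover have "ln (real N) \<ge> 0" using False by simp
    ultimately show ?thesis by simp
  qed (simp add: H_def)
  then show ?thesis by blast
next
  case False
  then show ?thesis
    using bounded_H complex_Re_le_cmod order.trans by meson
qed

text \<open>
  For \<open>z\<close> on the unit circle, \<open>3 + 4 Re z + Re z\<^sup>2 = 2 (1 + Re z)\<^sup>2\<close>. Weighting this with
  \<open>\<Lambda>(n)/n\<close> at \<open>z = chi n\<close> and summing gives at most \<open>3 ln N - 4 ln N + O(1)\<close> if \<open>L = 0\<close>, although every term is
  nonnegative.
\<close>

lemma L_nonzero_if_square_nonprincipal:
  assumes "\<exists>a. coprime a q \<and> chi a ^ 2 \<noteq> 1"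
  shows "L \<noteq> 0"
proof
  assume L: "L = 0"
  interpret sq: nonprincipal_character q "\<lambda>a. chi a ^ 2"
    using assms by unfold_locales
      (auto simp: q_pos mult period not_coprime power_mult_distrib)
  obtain C where C: "\<And>N. Re (sq.H N) \<le> C" using sq.Re_H_bounded_above by blast
  have le: "ln (real N) \<le> 12 + 8 * real q + C" if "N > 0" for N
  proof -
    have nonneg: "3 + 4 * Re (chi n) + Re (chi n ^ 2) \<ge> 0" for n
    proof (cases "coprime n q")
      case True
      have "Re (chi n) ^ 2 + Im (chi n) ^ 2 = 1"
        using norm_coprime[OF True] cmod_power2[of "chi n"] by simp
      then have "3 + 4 * Re (chi n) + Re (chi n ^ 2) = 2 * (1 + Re (chi n)) ^ 2"
        by (simp add: power2_eq_square algebra_simps)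
      then show ?thesis by simp
    qed (simp add: not_coprime)
    have "0 \<le> (\<Sum>n=1..N. mangoldt n / real n * (3 + 4 * Re (chi n) + Re (chi n ^ 2)))"
      by (intro sum_nonneg mult_nonneg_nonneg nonneg divide_nonneg_nonneg mangoldt_nonneg) auto
    also have "\<dots> = 3 * (\<Sum>n=1..N. mangoldt n / real n) + 4 * Re (H N) + Re (sq.H N)"
      unfolding H_def sq.H_def Re_sum sum_distrib_left sum.distrib [symmetric]
      by (intro sum.cong refl) (simp add: algebra_simps add_divide_distrib)
    also have "(\<Sum>n=1..N. mangoldt n / real n) \<le> ln (real N) + 4"
      using mertens_mangoldt[of N] that by linarith
    also have "Re (H N) \<le> 2 * real q - ln (real N)"
      using complex_Re_le_cmod[of "H N + of_real (ln (real N))"] H_if_L_eq_0[OF L that] by simp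
    also note C
    finally show ?thesis by simp
  qed
  have "filterlim (\<lambda>N. ln (real N)) at_top sequentially"
    by (intro filterlim_compose[OF ln_at_top filterlim_real_sequentially])
  then have "eventually (\<lambda>N. ln (real N) > 12 + 8 * real q + C) sequentially"
    by (simp add: filterlim_at_top_dense)
  then obtain N where "N > 0" "ln (real N) > 12 + 8 * real q + C"
    using eventually_happens[OF eventually_conj[OF eventually_gt_at_top[of 0]]] by auto
  with le[of N] show False by simp
qed

end

section \<open>Characters modulo powers of two\<close>

lemma ord_5_mod_twopow:
  assumes "m \<ge> 2"
  shows "ord (2 ^ m) (5 :: nat) = 2 ^ (m - 2)"
proof (cases "m = 2")
  case True
  have "[5 = 1] (mod (4 :: nat))" by (simp add: cong_def)
  then show ?thesis
    using True by (simp add: ord_eq_Suc_0_iff)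
next
  case False
  then show ?thesis
    using assms ord_twopow_3_5[of m 5] by simp
qed

lemma cong_power_5_iff:
  fixes i j :: nat
  assumes "m \<ge> 2"
  shows "[5 ^ i = (5 ^ j :: nat)] (mod 2 ^ m) \<longleftrightarrow> [i = j] (mod 2 ^ (m - 2))"
proof -
  have "coprime (2 ^ m) (5 :: nat)"
    by (rule coprime_power_left_iff[THEN iffD2]) simp
  from order_divides_expdiff[OF this, of i j] show ?thesis
    using assms by (simp add: ord_5_mod_twopow)
qed

lemma four_dvd_twopow: "m \<ge> 2 \<Longrightarrow> 4 dvd (2 ^ m :: nat)"
  using le_imp_power_dvd[of 2 m "2 :: nat"] by simp

lemma twopow_eq_4_mult: "m \<ge> 2 \<Longrightarrow> (2 ^ m :: nat) = 4 * 2 ^ (m - 2)"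
  using power_add[of "2 :: nat" 2 "m - 2"] by (simp only: le_add_diff_inverse) simp

text \<open>
  The powers of \<open>5\<close> are \<open>1\<close> modulo \<open>4\<close>, and \<open>5\<close> has order \<open>2 ^ (m - 2)\<close>, which is the number of residues
  modulo \<open>2 ^ m\<close> with this property.
\<close>

lemma power_5_surj:
  fixes n :: nat
  assumes "m \<ge> 2" "n mod 4 = 1"
  shows "\<exists>j. [5 ^ j = n] (mod 2 ^ m)"
proof -
  let ?N = "2 ^ (m - 2) :: nat"
  define A where "A = (\<lambda>k. 4 * k + 1) ` {..<?N}"
  define f where "f j = 5 ^ j mod (2 ^ m :: nat)" for j :: nat
  have A: "r \<in> A" if "r < 2 ^ m" "r mod 4 = 1" for r
  proof -
    have "r = 4 * (r div 4) + 1" using that(2) by presburger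
    moreover have "r div 4 < ?N" using that(1) twopow_eq_4_mult[OF assms(1)] by linarith
    ultimately show ?thesis unfolding A_def by blast
  qed
  have mod4: "f j mod 4 = 1" for j
  proof -
    have "f j mod 4 = 5 ^ j mod 4"
      using four_dvd_twopow[OF assms(1)] by (simp add: f_def mod_mod_cancel)
    also have "\<dots> = (5 mod 4) ^ j mod 4" by (simp only: power_mod)
    finally show ?thesis by simp
  qed
  have inj: "inj_on f {..<?N}"
  proof (rule inj_onI)
    fix i j assume ij: "i \<in> {..<?N}" "j \<in> {..<?N}" "f i = f j"
    then have "[i = j] (mod ?N)"
      using cong_power_5_iff[OF assms(1), of i j] by (simp add: f_def cong_def)
    then show "i = j" using ij by (simp add: cong_def)
  qed
  have "f ` {..<?N} = A"
  proof (rule card_subset_eq)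
    show "f ` {..<?N} \<subseteq> A" using A mod4 by (auto simp: f_def)
    have "card A = ?N" unfolding A_def by (subst card_image) (auto simp: inj_on_def)
    then show "card (f ` {..<?N}) = card A" using inj by (simp add: card_image)
  qed (simp add: A_def)
  moreover have "n mod 2 ^ m \<in> A"
    using assms four_dvd_twopow[OF assms(1)] by (intro A) (auto simp: mod_mod_cancel)
  ultimately obtain j where "f j = n mod 2 ^ m" by auto
  then show ?thesis by (auto simp: f_def cong_def)
qed

text \<open>
  A number that is \<open>1\<close> modulo \<open>8\<close> is an even power of \<open>5\<close>, so a character with values \<open>1\<close> and \<open>- 1\<close> has period \<open>8\<close>.
  With \<open>t = 8 k + 1\<close>, a block of eight terms contributes
  \<open>1/t + x/(t+2) + y/(t+4) + x y/(t+6)\<close> for signs \<open>x, y\<close> that are not both \<open>1\<close>. The three remaining cases are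
  positive, because \<open>1/t\<close> is decreasing and convex.
\<close>

lemma (in nonprincipal_character) L_nonzero_twopow:
  assumes q: "q = 2 ^ m" and m: "m \<ge> 2" and real: "\<And>a. coprime a q \<Longrightarrow> chi a ^ 2 = 1"
  shows "L \<noteq> 0"
proof -
  have coprime_q: "coprime a q \<longleftrightarrow> odd a" for a
    using m by (simp add: q coprime_power_right_iff coprime_right_2_iff_odd)
  have one_mod_8: "chi n = 1" if n: "n mod 8 = 1" for n
  proof -
    have "n mod 4 = 1" using n by presburger
    then obtain j where j: "[5 ^ j = n] (mod 2 ^ m)" using power_5_surj[OF m] by blast
    show ?thesis
    proof (cases "m = 2")
      case True
      then have "[n = Suc 0] (mod q)" using \<open>n mod 4 = 1\<close> by (simp add: q cong_def)
      from cong_imp_eq[OF this] show ?thesis by simp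
    next
      case False
      then have "(8 :: nat) dvd 2 ^ m" using m le_imp_power_dvd[of 3 m "2 :: nat"] by simp
      then have j8: "5 ^ j mod 8 = (1 :: nat)"
        using j n cong_dvd_modulus_nat by (metis cong_def)
      have "even j"
      proof (rule ccontr)
        assume "odd j"
        then obtain i where "j = 2 * i + 1" by (auto elim: oddE)
        then have "5 ^ j = 5 * (25 :: nat) ^ i" by (simp add: power_mult)
        moreover have "25 ^ i mod 8 = (1 :: nat)" using power_mod[of "25 :: nat" 8 i] by simp
        ultimately have "5 ^ j mod 8 = (5 :: nat)" using mod_mult_right_eq[of 5 "25 ^ i" "8 :: nat"] by simp
        then show False using j8 by simp
      qed
      then obtain i where "j = i * 2" by (auto elim: evenE)
      then have "chi n = chi (5 ^ i) ^ 2"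
        using cong_imp_eq[of "5 ^ j" n] j by (simp add: q power power_mult)
      also have "\<dots> = 1" by (intro real) (simp add: coprime_q)
      finally show ?thesis .
    qed
  qed
  have eq_mod_8: "chi n = chi r" if "odd r" "n mod 8 = r mod 8" for n r
  proof -
    have "(r * n) mod 8 = (r mod 8) * (r mod 8) mod 8"
      using that by (metis mod_mult_eq)
    moreover have "r mod 8 = 1 \<or> r mod 8 = 3 \<or> r mod 8 = 5 \<or> r mod 8 = 7"
      using that(1) by presburger
    ultimately have "(r * n) mod 8 = 1" by auto
    then have "chi r * chi n = chi r * chi r"
      using one_mod_8[of "r * n"] real[of r] that by (simp add: mult coprime_q power2_eq_square)
    moreover have "chi r \<noteq> 0" using real[of r] that by (auto simp: coprime_q)
    ultimately show ?thesis by simp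
  qed
  have even: "chi n = 0" if "even n" for n
    using not_coprime that by (simp add: coprime_q)
  have pm: "chi r = 1 \<or> chi r = - 1" if "odd r" for r
    using real[of r] that by (simp add: coprime_q power2_eq_1_iff)
  \<comment> \<open>Since \<open>3 * 5 = 15\<close> is \<open>7\<close> modulo \<open>8\<close>, two signs determine the character.\<close>
  have chi7: "chi 7 = chi 3 * chi 5"
    using eq_mod_8[of 7 15] mult[of 3 5] by simp
  have not_both: "\<not> (chi 3 = 1 \<and> chi 5 = 1)"
  proof
    assume *: "chi 3 = 1 \<and> chi 5 = 1"
    obtain a where a: "odd a" "chi a \<noteq> 1" using nonprincipal coprime_q by auto
    have "a mod 8 = 1 \<or> a mod 8 = 3 \<or> a mod 8 = 5 \<or> a mod 8 = 7"
      using a(1) by presburger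
    moreover have "chi a = chi (a mod 8)" using a by (intro eq_mod_8) (auto simp: dvd_mod_iff)
    ultimately show False using a * chi7 by auto
  qed
  define b where "b k = (\<Sum>n=k*8..<k*8+8. Re (chi n / of_nat n))" for k
  have "(\<lambda>n. Re (chi n / of_nat n)) sums Re L"
    unfolding L_def by (intro sums_Re summable_sums summable_L)
  from sums_group[OF this, of 8] have sums: "b sums Re L" by (simp add: b_def[abs_def])
  have b_pos: "b k > 0" for k
  proof -
    define t where "t = 8 * real k + 1"
    have t: "t > 0" by (simp add: t_def)
    have "{k*8..<k*8+8} = {8*k, 8*k+1, 8*k+2, 8*k+3, 8*k+4, 8*k+5, 8*k+6, 8*k+7}" by auto
    moreover have "chi (8*k+1) = 1" "chi (8*k+3) = chi 3" "chi (8*k+5) = chi 5" "chi (8*k+7) = chi 7"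
      using one_mod_8[of "8*k+1"] eq_mod_8[of 3 "8*k+3"] eq_mod_8[of 5 "8*k+5"] eq_mod_8[of 7 "8*k+7"]
      by simp_all
    ultimately have "b k = 1 / t + Re (chi 3) / (t + 2) + Re (chi 5) / (t + 4) + Re (chi 3 * chi 5) / (t + 6)"
      using chi7 by (simp add: b_def t_def even add_ac)
    moreover have "1 / t - 1 / (t + 2) > 0" "1 / (t + 4) - 1 / (t + 6) > 0"
        "1 / t - 1 / (t + 4) > 0" "1 / (t + 2) - 1 / (t + 6) > 0"
      using t by (simp_all add: divide_strict_left_mono)
    moreover have "1 / t - 1 / (t + 2) > 1 / (t + 4) - 1 / (t + 6)"
    proof -
      have "1 / t - 1 / (t + 2) = 2 / (t * (t + 2))" "1 / (t + 4) - 1 / (t + 6) = 2 / ((t + 4) * (t + 6))"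
        using t by (simp_all add: field_simps)
      moreover have "t * (t + 2) < (t + 4) * (t + 6)" using t by (intro mult_strict_mono) auto
      ultimately show ?thesis using t by (simp add: divide_strict_left_mono)
    qed
    ultimately show ?thesis
      using pm[of 3] pm[of 5] not_both by auto
  qed
  have "Re L > 0"
    using sums suminf_pos[OF sums_summable[OF sums] b_pos] by (simp add: sums_iff)
  then show ?thesis by auto
qed

text \<open>
  The representative among \<open>n\<close> and \<open>- n\<close> that is \<open>1\<close> modulo \<open>4\<close>; multiplication by \<open>2 ^ m - 1\<close> stands for
  negation modulo \<open>2 ^ m\<close> so that all numbers stay natural.
\<close>

definition sign_normalized :: "nat \<Rightarrow> nat \<Rightarrow> nat" where
  "sign_normalized m n = (if n mod 4 = 1 then n else (2 ^ m - 1) * n)"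

text \<open>The value is determined only modulo \<open>2 ^ (m - 2)\<close>.\<close>

definition dlog5 :: "nat \<Rightarrow> nat \<Rightarrow> nat" where
  "dlog5 m n = (SOME j. [5 ^ j = sign_normalized m n] (mod 2 ^ m))"

definition root_of_unity :: "nat \<Rightarrow> complex" where
  "root_of_unity N = exp (2 * of_real pi * \<i> / of_nat N)"

text \<open>
  The characters of the direct product of the signs and the cyclic group generated by \<open>5\<close>: the pair \<open>(u, v)\<close> gives the
  character that takes \<open>- 1\<close> to \<open>(- 1) ^ u\<close> and \<open>5\<close> to the \<open>v\<close>-th power of a primitive root of unity.
  The pairs with \<open>u < 2\<close> and \<open>v < 2 ^ (m - 2)\<close> give each character once.
\<close>

definition twopow_char :: "nat \<Rightarrow> nat \<times> nat \<Rightarrow> nat \<Rightarrow> complex" where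
  "twopow_char m uv n = (if even n then 0 else
     (if n mod 4 = 1 then 1 else (- 1) ^ fst uv)
       * root_of_unity (2 ^ (m - 2)) ^ (snd uv * dlog5 m n))"

lemma odd_mod_4_cases: "odd n \<Longrightarrow> n mod 4 = 1 \<or> n mod 4 = 3" for n :: nat
  by presburger

lemma pred_twopow_mod_4:
  assumes "m \<ge> 2"
  shows "(2 ^ m - 1) mod 4 = (3 :: nat)"
proof -
  obtain k where "(2 ^ m :: nat) = 4 * Suc k"
    using twopow_eq_4_mult[OF assms] by (metis Suc_pred zero_less_numeral zero_less_power)
  then have "(2 ^ m - 1 :: nat) = 4 * k + 3" by simp
  then show ?thesis by simp
qed

lemma sign_normalized_mod_4:
  assumes "m \<ge> 2" "odd n"
  shows "sign_normalized m n mod 4 = 1"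
proof -
  have "((2 ^ m - 1) * n) mod 4 = 3 * (n mod 4) mod 4"
    using pred_twopow_mod_4[OF assms(1)] by (metis mod_mult_left_eq mod_mult_right_eq)
  then show ?thesis
    using odd_mod_4_cases[OF assms(2)] by (auto simp: sign_normalized_def)
qed

lemma power_5_dlog5:
  assumes "m \<ge> 2" "odd n"
  shows "[5 ^ dlog5 m n = sign_normalized m n] (mod 2 ^ m)"
  unfolding dlog5_def
  by (rule someI_ex[OF power_5_surj[OF assms(1) sign_normalized_mod_4[OF assms]]])

lemma pred_twopow_square: "[(2 ^ m - 1) * (2 ^ m - 1) = 1] (mod (2 ^ m :: nat))"
proof -
  obtain k where k: "(2 ^ m :: nat) = Suc k" using not0_implies_Suc[of "2 ^ m"] by auto
  have "(k * k) mod Suc k = 1 mod Suc k"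
  proof (cases k)
    case (Suc j)
    then have "k * k = Suc 0 + j * Suc k" by simp
    then show ?thesis by (metis One_nat_def mod_mult_self1)
  qed simp
  then show ?thesis unfolding k cong_def by simp
qed

lemma sign_normalized_mult:
  assumes "m \<ge> 2" "odd a" "odd b"
  shows "[sign_normalized m (a * b) = sign_normalized m a * sign_normalized m b] (mod 2 ^ m)"
proof -
  have ab: "(a * b) mod 4 = (a mod 4) * (b mod 4) mod 4" by (simp add: mod_mult_eq)
  have "[(2 ^ m - 1) * (2 ^ m - 1) * (a * b) = 1 * (a * b)] (mod 2 ^ m)"
    by (intro cong_mult pred_twopow_square cong_refl)
  then have sq: "[a * b = (2 ^ m - 1) * a * ((2 ^ m - 1) * b)] (mod 2 ^ m)"
    by (subst cong_sym_eq) (simp only: mult_1 mult_ac)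
  from odd_mod_4_cases[OF assms(2)] odd_mod_4_cases[OF assms(3)] show ?thesis
    by (elim disjE) (use sq in \<open>simp_all add: sign_normalized_def ab mult.assoc mult.left_commute[of a]\<close>)
qed

lemma dlog5_mult:
  assumes "m \<ge> 2" "odd a" "odd b"
  shows "[dlog5 m (a * b) = dlog5 m a + dlog5 m b] (mod 2 ^ (m - 2))"
proof -
  have "[5 ^ dlog5 m (a * b) = sign_normalized m (a * b)] (mod 2 ^ m)"
    using assms by (intro power_5_dlog5) auto
  also have "[sign_normalized m (a * b) = sign_normalized m a * sign_normalized m b] (mod 2 ^ m)"
    by (rule sign_normalized_mult[OF assms])
  also have "[sign_normalized m a * sign_normalized m b = 5 ^ dlog5 m a * 5 ^ dlog5 m b] (mod 2 ^ m)"
    using assms by (intro cong_mult cong_sym[OF power_5_dlog5])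
  finally show ?thesis
    unfolding power_add[symmetric] cong_power_5_iff[OF assms(1)] .
qed

lemma mod_4_eq_if_cong_twopow:
  assumes "m \<ge> 2" "[a = b] (mod 2 ^ m)"
  shows "a mod 4 = b mod (4 :: nat)"
  using cong_dvd_modulus_nat[OF assms(2) four_dvd_twopow[OF assms(1)]] by (simp add: cong_def)

text \<open>An odd residue is determined by its sign and its discrete logarithm to the base \<open>5\<close>.\<close>

lemma cong_twopow_iff:
  assumes "m \<ge> 2" "odd a" "odd b"
  shows "[a = b] (mod 2 ^ m) \<longleftrightarrow> a mod 4 = b mod 4 \<and> [dlog5 m a = dlog5 m b] (mod 2 ^ (m - 2))"
proof -
  have "[sign_normalized m a = sign_normalized m b] (mod 2 ^ m) \<longleftrightarrow> [a = b] (mod 2 ^ m)"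
    if "a mod 4 = b mod 4"
  proof -
    have "coprime (2 ^ m - 1) (2 ^ m :: nat)"
      using coprime_diff_one_left_nat[of "2 ^ m"] by simp
    then show ?thesis using that by (simp add: sign_normalized_def cong_mult_lcancel_nat)
  qed
  moreover have "[sign_normalized m a = sign_normalized m b] (mod 2 ^ m)
      \<longleftrightarrow> [dlog5 m a = dlog5 m b] (mod 2 ^ (m - 2))"
    unfolding cong_power_5_iff[OF assms(1), symmetric]
    using power_5_dlog5[OF assms(1,2)] power_5_dlog5[OF assms(1,3)] by (simp add: cong_def)
  ultimately show ?thesis
    using mod_4_eq_if_cong_twopow[OF assms(1)] by blast
qed

lemma root_of_unity_power_eq_iff:
  assumes "N > 0"
  shows "root_of_unity N ^ i = root_of_unity N ^ j \<longleftrightarrow> [i = j] (mod N)"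
proof -
  have "root_of_unity N ^ k = exp (2 * of_real pi * \<i> * of_nat k / of_nat N)" for k
    unfolding root_of_unity_def exp_of_nat_mult[symmetric] by (simp add: field_simps)
  then show ?thesis
    using complex_root_unity_eq[of N i j] assms by (simp add: cong_def)
qed

lemma norm_root_of_unity [simp]: "norm (root_of_unity N) = 1"
  by (simp add: root_of_unity_def norm_exp_eq_Re)

lemma dirichlet_character_twopow_char:
  assumes "m \<ge> 2"
  shows "dirichlet_character (2 ^ m) (twopow_char m uv)"
proof
  let ?N = "2 ^ (m - 2) :: nat"
  have N: "?N > 0" by simp
  have root_cong: "root_of_unity ?N ^ (v * i) = root_of_unity ?N ^ (v * j)" if "[i = j] (mod ?N)" for i j v
    unfolding root_of_unity_power_eq_iff[OF N] by (intro cong_mult cong_refl that)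
  show "twopow_char m uv (Suc 0) = 1"
  proof -
    have "[5 ^ dlog5 m 1 = (5 ^ 0 :: nat)] (mod 2 ^ m)"
      using power_5_dlog5[OF assms, of 1] by (simp add: sign_normalized_def)
    then have "[dlog5 m 1 = 0] (mod ?N)" by (simp only: cong_power_5_iff[OF assms])
    from root_cong[OF this, of "snd uv"] show ?thesis by (simp add: twopow_char_def)
  qed
  show "twopow_char m uv (a * b) = twopow_char m uv a * twopow_char m uv b" for a b
  proof (cases "odd a \<and> odd b")
    case True
    have "root_of_unity ?N ^ (snd uv * dlog5 m (a * b))
        = root_of_unity ?N ^ (snd uv * dlog5 m a) * root_of_unity ?N ^ (snd uv * dlog5 m b)"
      using root_cong[OF dlog5_mult[OF assms], of a b "snd uv"] True
      by (simp add: power_add distrib_left)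
    moreover have "(if (a * b) mod 4 = 1 then 1 else (- 1) ^ fst uv)
        = (if a mod 4 = 1 then 1 else (- 1) ^ fst uv) * (if b mod 4 = 1 then 1 else (- 1 :: complex) ^ fst uv)"
    proof -
      have ab: "(a * b) mod 4 = (a mod 4) * (b mod 4) mod 4" by (simp add: mod_mult_eq)
      from True odd_mod_4_cases[of a] odd_mod_4_cases[of b] show ?thesis
        unfolding ab by (auto simp flip: power_mult_distrib)
    qed
    ultimately show ?thesis using True by (simp add: twopow_char_def)
  qed (auto simp: twopow_char_def)
  show "twopow_char m uv (a + 2 ^ m) = twopow_char m uv a" for a
  proof (cases "odd a")
    case True
    then have odd: "odd (a + 2 ^ m)" using assms by auto
    have "[a + 2 ^ m = a] (mod 2 ^ m)" by (simp add: cong_def)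
    then have "(a + 2 ^ m) mod 4 = a mod 4" "[dlog5 m (a + 2 ^ m) = dlog5 m a] (mod ?N)"
      using cong_twopow_iff[OF assms odd True] by auto
    with root_cong[of _ _ "snd uv"] show ?thesis using True odd by (simp add: twopow_char_def)
  next
    case False
    then show ?thesis using assms by (simp add: twopow_char_def)
  qed
  show "twopow_char m uv a = 0" if "\<not> coprime a (2 ^ m)" for a
    using that by (auto simp: twopow_char_def coprime_power_right_iff)
qed simp

lemma nonprincipal_twopow_char:
  assumes "m \<ge> 2" "uv \<in> {..<2} \<times> {..<2 ^ (m - 2)}" "uv \<noteq> (0, 0)"
  shows "nonprincipal_character (2 ^ m) (twopow_char m uv)"
proof -
  interpret dirichlet_character "2 ^ m" "twopow_char m uv"
    by (rule dirichlet_character_twopow_char[OF assms(1)])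
  have "\<exists>a. odd a \<and> twopow_char m uv a \<noteq> 1"
  proof (cases "snd uv = 0")
    case True
    then have "fst uv = 1" using assms by (cases uv) (auto simp: less_Suc_eq numeral_2_eq_2)
    then show ?thesis using True by (intro exI[of _ 3]) (simp add: twopow_char_def)
  next
    case False
    have "[5 ^ dlog5 m 5 = (5 ^ 1 :: nat)] (mod 2 ^ m)"
      using power_5_dlog5[OF assms(1), of 5] by (simp add: sign_normalized_def)
    then have "[dlog5 m 5 = 1] (mod 2 ^ (m - 2))" by (simp only: cong_power_5_iff[OF assms(1)])
    then have "[snd uv * dlog5 m 5 = snd uv * 1] (mod 2 ^ (m - 2))" by (intro cong_mult cong_refl)
    moreover have "\<not> [snd uv = 0] (mod 2 ^ (m - 2))"
      using False assms(2) by (cases uv) (auto simp: cong_def)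
    ultimately have "\<not> [snd uv * dlog5 m 5 = 0] (mod 2 ^ (m - 2))" by (simp add: cong_def)
    then have "root_of_unity (2 ^ (m - 2)) ^ (snd uv * dlog5 m 5) \<noteq> 1"
      using root_of_unity_power_eq_iff[of "2 ^ (m - 2)" "snd uv * dlog5 m 5" 0] by simp
    then show ?thesis by (intro exI[of _ 5]) (simp add: twopow_char_def)
  qed
  then show ?thesis
    using assms(1) by unfold_locales (auto simp: coprime_power_right_iff)
qed

text \<open>
  The double sum factors into a sum of two signs and a geometric sum of roots of unity; each of them
  vanishes unless the corresponding coordinates of \<open>a\<close> and \<open>n\<close> agree.
\<close>

lemma twopow_char_orthogonality:
  assumes "m \<ge> 2" "odd a" "odd n"
  shows "(\<Sum>uv\<in>{..<2} \<times> {..<2 ^ (m - 2)}. cnj (twopow_char m uv a) * twopow_char m uv n)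
    = (if [n = a] (mod 2 ^ m) then 2 ^ (m - 1) else 0)"
proof -
  let ?N = "2 ^ (m - 2) :: nat"
  define w where "w = root_of_unity ?N"
  define s where "s k = (if k mod 4 = 1 then 1 else - 1 :: complex)" for k :: nat
  define z where "z = cnj (w ^ dlog5 m a) * w ^ dlog5 m n"
  have char: "twopow_char m uv k = s k ^ fst uv * (w ^ dlog5 m k) ^ snd uv" if "odd k" for k uv
    using that by (simp add: twopow_char_def s_def w_def mult.commute flip: power_mult)
  have "(\<Sum>uv\<in>{..<2} \<times> {..<?N}. cnj (twopow_char m uv a) * twopow_char m uv n)
      = (\<Sum>uv\<in>{..<2} \<times> {..<?N}. (s a * s n) ^ fst uv * z ^ snd uv)"
    using assms by (intro sum.cong refl) (simp add: char z_def power_mult_distrib s_def)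
  also have "\<dots> = (\<Sum>u<2. (s a * s n) ^ u) * (\<Sum>v<?N. z ^ v)"
    by (simp add: sum_product sum.cartesian_product case_prod_unfold)
  also have "(\<Sum>u<2. (s a * s n) ^ u) = (if a mod 4 = n mod 4 then 2 else 0)"
    using odd_mod_4_cases[OF assms(2)] odd_mod_4_cases[OF assms(3)]
    by (auto simp: s_def numeral_2_eq_2)
  also have "(\<Sum>v<?N. z ^ v) = (if [dlog5 m a = dlog5 m n] (mod ?N) then of_nat ?N else 0)"
  proof -
    have unit: "cnj (w ^ k) * w ^ k = 1" for k
      by (simp add: w_def norm_power mult.commute[of "cnj _"] complex_norm_square[symmetric]
          del: complex_cnj_power)
    have "z = 1 \<longleftrightarrow> w ^ dlog5 m n = w ^ dlog5 m a"
    proof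
      assume "z = 1"
      have "w ^ dlog5 m n = (cnj (w ^ dlog5 m a) * w ^ dlog5 m a) * w ^ dlog5 m n"
        by (simp only: unit mult_1)
      also have "\<dots> = w ^ dlog5 m a * z" by (simp only: z_def mult_ac)
      finally show "w ^ dlog5 m n = w ^ dlog5 m a" by (simp only: \<open>z = 1\<close> mult_1_right)
    qed (simp only: z_def unit)
    then have z1: "z = 1 \<longleftrightarrow> [dlog5 m a = dlog5 m n] (mod ?N)"
      using root_of_unity_power_eq_iff[of ?N "dlog5 m n" "dlog5 m a"] by (simp add: w_def cong_sym_eq)
    have "w ^ ?N = 1"
      using root_of_unity_power_eq_iff[of ?N ?N 0] by (simp add: w_def cong_def)
    moreover have "z ^ ?N = cnj ((w ^ ?N) ^ dlog5 m a) * (w ^ ?N) ^ dlog5 m n"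
      unfolding z_def power_mult_distrib complex_cnj_power by (simp only: mult.commute flip: power_mult)
    ultimately have "z ^ ?N = 1" by simp
    then have "(\<Sum>v<?N. z ^ v) = 0" if "z \<noteq> 1"
      using geometric_sum[OF that, of ?N] by simp
    then show ?thesis unfolding z1[symmetric] by auto
  qed
  finally show ?thesis
    using cong_twopow_iff[OF assms(1,3,2)] assms(1) Suc_diff_Suc[of 1 m] power_Suc[of "2 :: complex" "m - 2"]
    by (auto simp: cong_sym_eq numeral_2_eq_2)
qed

section \<open>Mertens' theorem in progressions modulo powers of two\<close>

lemma ln_over_square_le:
  assumes "n > 0"
  shows "ln (real n) / real n ^ 2 \<le> 2 * real n powr (- 3 / 2)"
proof -
  have "ln (real n) / real n ^ 2 \<le> (real n powr (1 / 2) / (1 / 2)) / real n ^ 2"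
    using assms by (intro divide_right_mono ln_powr_bound) auto
  also have "\<dots> = 2 * (real n powr (1 / 2) / real n powr 2)"
    using assms by simp
  also have "real n powr (1 / 2) / real n powr 2 = real n powr (- 3 / 2)"
    unfolding powr_diff[symmetric] by simp
  finally show ?thesis .
qed

text \<open>
  The proper powers of \<open>p\<close> contribute at most \<open>2 ln p / p\<^sup>2\<close>, a geometric sum, and this is summable even over
  all integers.
\<close>

lemma sum_mangoldt_nonprime_bounded:
  "\<exists>C. \<forall>N. (\<Sum>n | n \<in> {1..N} \<and> \<not> prime n. mangoldt n / real n) \<le> C"
proof -
  have "summable (\<lambda>n. real n powr (- 3 / 2))"
    by (subst summable_real_powr_iff) simp
  then obtain C where C: "\<And>N. norm (\<Sum>n<N. real n powr (- 3 / 2)) \<le> C"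
    using summable_imp_sums_bounded[of "\<lambda>n. real n powr (- 3 / 2)"] by (auto simp: bounded_iff)
  have "(\<Sum>n | n \<in> {1..N} \<and> \<not> prime n. mangoldt n / real n) \<le> 4 * C" for N
  proof -
    define T where "T = (SIGMA p:{p \<in> {1..N}. prime p}. {2..N})"
    define f where "f = (\<lambda>(p, k). p ^ k :: nat)"
    let ?S = "{n \<in> {1..N}. \<not> prime n \<and> primepow n}"
    have "(\<Sum>n | n \<in> {1..N} \<and> \<not> prime n. mangoldt n / real n) = (\<Sum>n\<in>?S. mangoldt n / real n)"
      by (intro sum.mono_neutral_right) (auto simp: mangoldt_def)
    also have "\<dots> \<le> (\<Sum>n\<in>f ` T. mangoldt n / real n)"
    proof (intro sum_mono2)
      show "?S \<subseteq> f ` T"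
      proof
        fix n assume n: "n \<in> ?S"
        then obtain p k where pk: "prime p" "k > 0" "n = p ^ k" by (auto simp: primepow_def)
        have "k \<noteq> 1" using n pk by auto
        moreover have "p \<le> n" using pk n dvd_imp_le[of p n] by (auto simp: dvd_power)
        moreover have "k < n" using pk prime_gt_1_nat[of p] power_gt_expt[of p k] by simp
        ultimately have "(p, k) \<in> T"
          using n pk prime_gt_0_nat[of p] by (auto simp: T_def)
        then show "n \<in> f ` T" using pk by (auto simp: f_def image_iff intro: bexI[of _ "(p, k)"])
      qed
    qed (auto simp: T_def mangoldt_nonneg)
    also have "\<dots> \<le> (\<Sum>x\<in>T. mangoldt (f x) / real (f x))"
      using sum_image_le[of T "\<lambda>n. mangoldt n / real n" f]
      by (simp add: T_def mangoldt_nonneg o_def)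
    also have "\<dots> = (\<Sum>p | p \<in> {1..N} \<and> prime p. \<Sum>k=2..N. mangoldt (p ^ k) / real (p ^ k))"
      unfolding T_def f_def by (subst sum.Sigma) (auto simp: case_prod_unfold)
    also have "\<dots> \<le> (\<Sum>p | p \<in> {1..N} \<and> prime p. 4 * real p powr (- 3 / 2))"
    proof (intro sum_mono)
      fix p assume p: "p \<in> {p. p \<in> {1..N} \<and> prime p}"
      define x where "x = 1 / real p"
      have p2: "p \<ge> 2" using p prime_ge_2_nat by auto
      have x: "0 < x" "x \<le> 1 / 2" using p2 by (auto simp: x_def field_simps)
      have "(1 - x) * (\<Sum>k=2..N. x ^ k) \<le> x ^ 2"
        using sum_gp_multiplied[of 2 N x] x by (cases "N \<ge> 2") auto
      moreover have "(1 / 2) * (\<Sum>k=2..N. x ^ k) \<le> (1 - x) * (\<Sum>k=2..N. x ^ k)"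
        using x by (intro mult_right_mono sum_nonneg) auto
      ultimately have geo: "(\<Sum>k=2..N. x ^ k) \<le> 2 * x ^ 2" by simp
      have "(\<Sum>k=2..N. mangoldt (p ^ k) / real (p ^ k)) = (\<Sum>k=2..N. ln (real p) * x ^ k)"
        using p by (intro sum.cong refl) (auto simp: x_def power_divide)
      also have "\<dots> \<le> ln (real p) * (2 * x ^ 2)"
        unfolding sum_distrib_left[symmetric] using geo p2 by (intro mult_left_mono) auto
      also have "\<dots> = 2 * (ln (real p) / real p ^ 2)" by (simp add: x_def power_divide)
      also have "\<dots> \<le> 2 * (2 * real p powr (- 3 / 2))"
        using p2 by (intro mult_left_mono ln_over_square_le) auto
      finally show "(\<Sum>k=2..N. mangoldt (p ^ k) / real (p ^ k)) \<le> 4 * real p powr (- 3 / 2)"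
        by simp
    qed
    also have "\<dots> \<le> (\<Sum>p<Suc N. 4 * real p powr (- 3 / 2))"
      by (intro sum_mono2) auto
    also have "\<dots> \<le> 4 * C"
      unfolding sum_distrib_left[symmetric] using C[of "Suc N"] by simp
    finally show ?thesis .
  qed
  then show ?thesis by blast
qed

text \<open>
  For the principal character, the sum differs from the classical one only in the powers of \<open>2\<close>; of these
  only \<open>2\<close> itself is prime, so the bound for nonprime arguments takes care of the others.
\<close>

lemma bounded_H_twopow_char:
  assumes "m \<ge> 2" "uv \<in> {..<2} \<times> {..<2 ^ (m - 2)}"
  shows "\<exists>C. \<forall>N\<ge>1. norm (dirichlet_character.H (twopow_char m uv) N
           - (if uv = (0, 0) then of_real (ln (real N)) else 0)) \<le> C"
proof (cases "uv = (0, 0)")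
  case False
  interpret nonprincipal_character "2 ^ m" "twopow_char m uv"
    by (rule nonprincipal_twopow_char[OF assms False])
  have "L \<noteq> 0"
  proof (cases "\<exists>a. coprime a (2 ^ m) \<and> twopow_char m uv a ^ 2 \<noteq> 1")
    case True
    then show ?thesis by (rule L_nonzero_if_square_nonprincipal)
  next
    case False
    then show ?thesis by (intro L_nonzero_twopow[OF refl assms(1)]) auto
  qed
  from bounded_H[OF this] show ?thesis using False by auto
next
  case True
  interpret dirichlet_character "2 ^ m" "twopow_char m uv"
    by (rule dirichlet_character_twopow_char[OF assms(1)])
  obtain C where C: "\<And>N. (\<Sum>n | n \<in> {1..N} \<and> \<not> prime n. mangoldt n / real n) \<le> C"
    using sum_mangoldt_nonprime_bounded by blast
  have "norm (H N - of_real (ln (real N))) \<le> 4 + (C + 1)" if "N \<ge> 1" for N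
  proof -
    let ?E = "\<Sum>n | n \<in> {1..N} \<and> even n. mangoldt n / real n"
    have "H N = of_real (\<Sum>n=1..N. if odd n then mangoldt n / real n else 0)"
      unfolding H_def of_real_sum using True
      by (intro sum.cong refl) (auto simp: twopow_char_def)
    also have "(\<Sum>n=1..N. if odd n then mangoldt n / real n else 0) = (\<Sum>n | n \<in> {1..N} \<and> odd n. mangoldt n / real n)"
      by (rule sum.inter_filter [symmetric]) simp
    also have "\<dots> = (\<Sum>n=1..N. mangoldt n / real n) - ?E"
    proof -
      have split: "{1..N} = {n. n \<in> {1..N} \<and> odd n} \<union> {n. n \<in> {1..N} \<and> even n}" by auto
      have "(\<Sum>n=1..N. mangoldt n / real n) = (\<Sum>n | n \<in> {1..N} \<and> odd n. mangoldt n / real n) + ?E"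
        by (subst split, rule sum.union_disjoint) auto
      then show ?thesis by simp
    qed
    finally have "H N - of_real (ln (real N))
      = of_real ((\<Sum>n=1..N. mangoldt n / real n) - ln (real N) - ?E)" by simp
    moreover have "0 \<le> ?E" by (intro sum_nonneg divide_nonneg_nonneg mangoldt_nonneg) auto
    moreover have "?E \<le> C + 1"
    proof -
      have "?E \<le> (\<Sum>n\<in>insert 2 {n. n \<in> {1..N} \<and> \<not> prime n}. mangoldt n / real n)"
        by (intro sum_mono2) (auto simp: mangoldt_nonneg intro: prime_odd_nat dest: primes_dvd_imp_eq[OF two_is_prime_nat])
      also have "\<dots> = mangoldt 2 / 2 + (\<Sum>n | n \<in> {1..N} \<and> \<not> prime n. mangoldt n / real n)"
        by (subst sum.insert) auto
      also have "mangoldt 2 / 2 \<le> (1 :: real)" using ln_2_less_1 by simp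
      finally show ?thesis using C[of N] by simp
    qed
    ultimately show ?thesis
      using mertens_mangoldt[OF that] by (simp only: norm_of_real)
  qed
  then show ?thesis using True by auto
qed

lemma mertens_mangoldt_twopow:
  assumes "m \<ge> 2" "odd a"
  shows "\<exists>C. \<forall>N\<ge>1. \<bar>(\<Sum>n | n \<in> {1..N} \<and> [n = a] (mod 2 ^ m). mangoldt n / real n)
           - ln (real N) / 2 ^ (m - 1)\<bar> \<le> C"
proof -
  define I where "I = {..<2 :: nat} \<times> {..<2 ^ (m - 2) :: nat}"
  let ?H = "\<lambda>uv. dirichlet_character.H (twopow_char m uv)"
  define main where "main uv N = (if uv = (0 :: nat, 0 :: nat) then of_real (ln (real N)) else 0 :: complex)" for uv N
  have "\<forall>uv\<in>I. \<exists>C. \<forall>N\<ge>1. norm (?H uv N - main uv N) \<le> C"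
    using bounded_H_twopow_char[OF assms(1)] by (simp add: I_def main_def)
  then obtain C where C: "\<And>uv N. uv \<in> I \<Longrightarrow> N \<ge> 1 \<Longrightarrow> norm (?H uv N - main uv N) \<le> C uv"
    by metis
  have "\<bar>(\<Sum>n | n \<in> {1..N} \<and> [n = a] (mod 2 ^ m). mangoldt n / real n) - ln (real N) / 2 ^ (m - 1)\<bar>
      \<le> (\<Sum>uv\<in>I. C uv) / 2 ^ (m - 1)" if "N \<ge> 1" for N
  proof -
    let ?S = "\<Sum>n | n \<in> {1..N} \<and> [n = a] (mod 2 ^ m). mangoldt n / real n"
    have "(\<Sum>uv\<in>I. cnj (twopow_char m uv a) * ?H uv N)
        = (\<Sum>uv\<in>I. \<Sum>n=1..N. cnj (twopow_char m uv a) * twopow_char m uv n * of_real (mangoldt n / real n))"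
      unfolding dirichlet_character.H_def[OF dirichlet_character_twopow_char[OF assms(1)]] sum_distrib_left
      by (intro sum.cong refl) simp
    also have "\<dots> = (\<Sum>n=1..N. (\<Sum>uv\<in>I. cnj (twopow_char m uv a) * twopow_char m uv n) * of_real (mangoldt n / real n))"
      by (subst sum.swap) (simp only: sum_distrib_right)
    also have "\<dots> = (\<Sum>n=1..N. if [n = a] (mod 2 ^ m) then 2 ^ (m - 1) * of_real (mangoldt n / real n) else 0)"
    proof (intro sum.cong refl)
      fix n
      show "(\<Sum>uv\<in>I. cnj (twopow_char m uv a) * twopow_char m uv n) * of_real (mangoldt n / real n)
          = (if [n = a] (mod 2 ^ m) then 2 ^ (m - 1) * of_real (mangoldt n / real n) else 0)"
      proof (cases "odd n")
        case True
        then show ?thesis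
          using twopow_char_orthogonality[OF assms True] by (simp add: I_def)
      next
        case False
        have "n mod 2 \<noteq> a mod 2" using False assms(2) by presburger
        then have "\<not> [n = a] (mod 2 ^ m)"
          using mod_4_eq_if_cong_twopow[OF assms(1), of n a] by (metis mod_mod_cancel even_numeral dvd_triv_left mult_2 numeral_Bit0)
        then show ?thesis using False by (simp add: twopow_char_def)
      qed
    qed
    also have "\<dots> = (\<Sum>n=1..N. of_real (if [n = a] (mod 2 ^ m) then 2 ^ (m - 1) * (mangoldt n / real n) else 0))"
      by (intro sum.cong refl) auto
    also have "\<dots> = of_real (\<Sum>n=1..N. if [n = a] (mod 2 ^ m) then 2 ^ (m - 1) * (mangoldt n / real n) else 0)"
      by (rule of_real_sum [symmetric])
    also have "(\<Sum>n=1..N. if [n = a] (mod 2 ^ m) then 2 ^ (m - 1) * (mangoldt n / real n) else 0) = 2 ^ (m - 1) * ?S"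
      by (simp only: sum.inter_filter [symmetric] sum_distrib_left finite_atLeastAtMost)
    finally have eq: "of_real (2 ^ (m - 1) * ?S) = (\<Sum>uv\<in>I. cnj (twopow_char m uv a) * ?H uv N)" ..
    have "(\<Sum>uv\<in>I. cnj (twopow_char m uv a) * main uv N) = (\<Sum>uv\<in>{(0, 0)}. cnj (twopow_char m uv a) * main uv N)"
      by (intro sum.mono_neutral_right) (auto simp: I_def main_def)
    also have "\<dots> = of_real (ln (real N))" using assms(2) by (simp add: main_def twopow_char_def)
    finally have "complex_of_real (2 ^ (m - 1) * ?S - ln (real N))
        = (\<Sum>uv\<in>I. cnj (twopow_char m uv a) * (?H uv N - main uv N))"
      unfolding of_real_diff eq by (simp add: right_diff_distrib sum_subtractf)
    also have "norm \<dots> \<le> (\<Sum>uv\<in>I. C uv)"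
    proof (intro sum_norm_le)
      fix uv assume uv: "uv \<in> I"
      have "norm (twopow_char m uv a) * norm (?H uv N - main uv N) \<le> 1 * C uv"
        using dirichlet_character.norm_le_1[OF dirichlet_character_twopow_char[OF assms(1)]]
        by (intro mult_mono C uv that) auto
      then show "norm (cnj (twopow_char m uv a) * (?H uv N - main uv N)) \<le> C uv"
        by (simp add: norm_mult)
    qed
    finally have "\<bar>2 ^ (m - 1) * ?S - ln (real N)\<bar> \<le> (\<Sum>uv\<in>I. C uv)"
      by (simp only: norm_of_real)
    moreover have "?S - ln (real N) / 2 ^ (m - 1) = (2 ^ (m - 1) * ?S - ln (real N)) / 2 ^ (m - 1)"
      by (simp add: field_simps)
    ultimately show ?thesis by (simp add: divide_right_mono)
  qed
  then show ?thesis by blast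
qed

lemma mertens_log_primes_twopow:
  assumes "m \<ge> 2" "odd a"
  shows "\<exists>C. \<forall>N\<ge>1. \<bar>(\<Sum>n | n \<in> {1..N} \<and> prime n \<and> [n = a] (mod 2 ^ m). ln (real n) / real n)
           - ln (real N) / 2 ^ (m - 1)\<bar> \<le> C"
proof -
  obtain C1 where C1: "\<And>N. N \<ge> 1 \<Longrightarrow>
      \<bar>(\<Sum>n | n \<in> {1..N} \<and> [n = a] (mod 2 ^ m). mangoldt n / real n) - ln (real N) / 2 ^ (m - 1)\<bar> \<le> C1"
    using mertens_mangoldt_twopow[OF assms] by blast
  obtain C2 where C2: "\<And>N. (\<Sum>n | n \<in> {1..N} \<and> \<not> prime n. mangoldt n / real n) \<le> C2"
    using sum_mangoldt_nonprime_bounded by blast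
  have "\<bar>(\<Sum>n | n \<in> {1..N} \<and> prime n \<and> [n = a] (mod 2 ^ m). ln (real n) / real n)
           - ln (real N) / 2 ^ (m - 1)\<bar> \<le> C1 + C2" if "N \<ge> 1" for N
  proof -
    let ?A = "{n. n \<in> {1..N} \<and> prime n \<and> [n = a] (mod 2 ^ m)}"
    let ?B = "{n. n \<in> {1..N} \<and> \<not> prime n \<and> [n = a] (mod 2 ^ m)}"
    let ?g = "\<lambda>n. mangoldt n / real n"
    have "{n. n \<in> {1..N} \<and> [n = a] (mod 2 ^ m)} = ?A \<union> ?B" by auto
    then have "(\<Sum>n | n \<in> {1..N} \<and> [n = a] (mod 2 ^ m). ?g n) = sum ?g ?A + sum ?g ?B"
      by (simp only:) (rule sum.union_disjoint, auto)
    moreover have "sum ?g ?A = (\<Sum>n\<in>?A. ln (real n) / real n)"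
      by (intro sum.cong refl) simp
    moreover have "sum ?g ?B \<le> C2"
    proof -
      have "sum ?g ?B \<le> (\<Sum>n | n \<in> {1..N} \<and> \<not> prime n. ?g n)"
        by (intro sum_mono2) (auto simp: mangoldt_nonneg)
      then show ?thesis using C2[of N] by simp
    qed
    moreover have "sum ?g ?B \<ge> 0"
      by (intro sum_nonneg divide_nonneg_nonneg mangoldt_nonneg) auto
    ultimately show ?thesis using C1[OF that] by linarith
  qed
  then show ?thesis by blast
qed

text \<open>
  The integral test, shifted by two so that \<open>1 / (x ln x)\<close> is monotone and finite on the whole half line.
\<close>

lemma sum_inverse_n_ln_n_convergent:
  "convergent (\<lambda>N. (\<Sum>k\<le>N. 1 / ((real k + 2) * ln (real k + 2))) - ln (ln (real N + 2)))"
proof -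
  define f :: "real \<Rightarrow> real" where "f x = 1 / ((x + 2) * ln (x + 2))" for x
  interpret antimono_fun_sum_integral_diff f
  proof
    show "f y \<le> f x" if "x \<ge> 0" "x \<le> y" for x y
      unfolding f_def using that by (intro divide_left_mono mult_mono mult_pos_pos) auto
    show "f x \<ge> 0" if "x \<ge> 0" for x
      using that by (simp add: f_def)
    show "continuous_on {0..} f"
      unfolding f_def by (intro continuous_intros) auto
  qed
  have "integral {0..real N} f = ln (ln (real N + 2)) - ln (ln 2)" for N
  proof -
    have "(f has_integral (ln (ln (real N + 2)) - ln (ln (0 + 2)))) {0..real N}"
    proof (rule fundamental_theorem_of_calculus)
      fix x assume "x \<in> {0..real N}"
      then show "((\<lambda>x. ln (ln (x + 2))) has_vector_derivative f x) (at x within {0..real N})"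
        unfolding f_def has_real_derivative_iff_has_vector_derivative[symmetric]
        by (auto intro!: derivative_eq_intros simp: field_simps)
    qed auto
    then show ?thesis by (simp add: integral_unique)
  qed
  then have "sum_integral_diff_series = (\<lambda>N. ((\<Sum>k\<le>N. f (real k)) - ln (ln (real N + 2))) + ln (ln 2))"
    by (simp add: fun_eq_iff sum_integral_diff_series_def)
  then have "convergent (\<lambda>N. ((\<Sum>k\<le>N. f (real k)) - ln (ln (real N + 2))) + ln (ln 2))"
    using sum_integral_diff_series_convergent by simp
  from convergent_diff[OF this convergent_const[of "ln (ln 2)"]] show ?thesis
    by (simp add: f_def)
qed

text \<open>
  Subtracting \<open>c / n\<close> from the terms \<open>ln n / n\<close> makes their partial sums bounded, by the
  hypothesis and since the harmonic numbers are \<open>ln N + O(1)\<close>. Dirichlet's test with the weights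
  \<open>1 / ln n\<close> then gives convergence, and the subtracted part becomes \<open>c\<close> times the sum of \<open>1 / (n ln n)\<close>, that is,
  \<open>c ln ln N\<close> up to a convergent quantity.
\<close>

lemma mertens_primes_if_log:
  fixes P :: "nat \<Rightarrow> bool" and c :: real
  assumes "\<And>N. N \<ge> 1 \<Longrightarrow> \<bar>(\<Sum>n | n \<in> {1..N} \<and> P n. ln (real n) / real n) - c * ln (real N)\<bar> \<le> C"
  shows "convergent (\<lambda>N. (\<Sum>n | n \<in> {2..N} \<and> P n. 1 / real n) - c * ln (ln (real N)))"
proof -
  define b where "b n = (if P n then ln (real n) / real n else 0) - c / real n" for n
  have "Bseq (\<lambda>n. harm n - ln (real n))"
    using euler_mascheroni_convergent by (rule convergent_imp_Bseq)
  then obtain D where D: "\<And>n. norm (harm n - ln (real n)) \<le> D"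
    by (auto simp: Bseq_def)
  have "norm (\<Sum>n<N. b n) \<le> C + \<bar>c\<bar> * D + \<bar>C\<bar>" for N
  proof (cases "N \<ge> 2")
    case True
    define M where "M = N - 1"
    have M: "N = Suc M" "M \<ge> 1" using True by (auto simp: M_def)
    have "(\<Sum>n<N. b n) = (\<Sum>n=1..M. b n)"
      by (intro sum.mono_neutral_right) (auto simp: M b_def Suc_le_eq)
    also have "\<dots> = (\<Sum>n | n \<in> {1..M} \<and> P n. ln (real n) / real n) - c * harm M"
      by (simp add: b_def sum_subtractf harm_def sum_distrib_left divide_inverse sum.inter_filter[symmetric])
    also have "\<dots> = ((\<Sum>n | n \<in> {1..M} \<and> P n. ln (real n) / real n) - c * ln (real M)) - c * (harm M - ln (real M))"
      by (simp add: algebra_simps)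
    also have "norm \<dots> \<le> C + \<bar>c\<bar> * D"
    proof (rule norm_triangle_le_diff[OF add_mono])
      show "norm ((\<Sum>n | n \<in> {1..M} \<and> P n. ln (real n) / real n) - c * ln (real M)) \<le> C"
        using assms[OF M(2)] by simp
      show "norm (c * (harm M - ln (real M))) \<le> \<bar>c\<bar> * D"
        using D[of M] by (simp add: abs_mult mult_left_mono)
    qed
    finally show ?thesis by simp
  next
    case False
    then have "N = 0 \<or> N = 1" by auto
    then have "(\<Sum>n<N. b n) = 0" by (auto simp: b_def)
    moreover have "D \<ge> 0" using D[of 0] norm_ge_zero order.trans by blast
    moreover have "C \<ge> 0" using assms[of 1] by linarith
    ultimately show ?thesis by simp
  qed
  then have "summable (\<lambda>n. (1 / ln (real n)) *\<^sub>R b n)"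
  proof (rule summable_dirichlet_test[of 2, rotated 2])
    show "1 / ln (real (Suc k)) \<le> 1 / ln (real k)" if "k \<ge> 2" for k
      using that by (intro divide_left_mono) auto
    show "(\<lambda>n. 1 / ln (real n)) \<longlonglongrightarrow> 0"
      by (intro tendsto_divide_0[OF tendsto_const] filterlim_at_top_imp_at_infinity
            filterlim_compose[OF ln_at_top filterlim_real_sequentially])
  qed
  then have "convergent (\<lambda>N. \<Sum>n<N. (1 / ln (real n)) *\<^sub>R b n)"
    by (simp add: summable_iff_convergent)
  then have 1: "convergent (\<lambda>N. \<Sum>n<N + 3. (1 / ln (real n)) *\<^sub>R b n)"
    by (subst convergent_ignore_initial_segment)
  have eq: "(\<Sum>n<N + 3. (1 / ln (real n)) *\<^sub>R b n)
      = (\<Sum>n | n \<in> {2..N + 2} \<and> P n. 1 / real n) - c * (\<Sum>k\<le>N. 1 / ((real k + 2) * ln (real k + 2)))" for N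
  proof -
    have "(\<Sum>n<N + 3. (1 / ln (real n)) *\<^sub>R b n) = (\<Sum>n=2..N + 2. (1 / ln (real n)) *\<^sub>R b n)"
    proof (intro sum.mono_neutral_right)
      show "\<forall>i\<in>{..<N + 3} - {2..N + 2}. (1 / ln (real i)) *\<^sub>R b i = 0"
      proof
        fix i assume "i \<in> {..<N + 3} - {2..N + 2}"
        \<comment> \<open>The term at \<open>1\<close> disappears because \<open>1 / ln 1 = 0\<close>.\<close>
        then have "i = 0 \<or> i = 1" by auto
        then show "(1 / ln (real i)) *\<^sub>R b i = 0" by auto
      qed
    qed auto
    also have "\<dots> = (\<Sum>n=2..N + 2. (if P n then 1 / real n else 0) - c * (1 / (real n * ln (real n))))"
      by (intro sum.cong refl) (auto simp: b_def field_simps)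
    also have "\<dots> = (\<Sum>n | n \<in> {2..N + 2} \<and> P n. 1 / real n) - c * (\<Sum>n=2..N + 2. 1 / (real n * ln (real n)))"
      by (simp only: sum_subtractf sum_distrib_left sum.inter_filter[symmetric] finite_atLeastAtMost)
    also have "(\<Sum>n=2..N + 2. 1 / (real n * ln (real n))) = (\<Sum>k\<le>N. 1 / ((real k + 2) * ln (real k + 2)))"
      by (rule sum.reindex_bij_witness[of _ "\<lambda>k. k + 2" "\<lambda>n. n - 2"]) (auto simp: of_nat_diff)
    finally show ?thesis .
  qed
  have "convergent (\<lambda>N. (\<Sum>n<N + 3. (1 / ln (real n)) *\<^sub>R b n)
      + c * ((\<Sum>k\<le>N. 1 / ((real k + 2) * ln (real k + 2))) - ln (ln (real N + 2))))"
    by (intro convergent_add 1 convergent_mult convergent_const sum_inverse_n_ln_n_convergent)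
  then have "convergent (\<lambda>N. (\<Sum>n | n \<in> {2..N + 2} \<and> P n. 1 / real n) - c * ln (ln (real (N + 2))))"
    unfolding eq by (simp add: algebra_simps)
  then show ?thesis
    by (subst (asm) convergent_ignore_initial_segment)
qed

section \<open>From sums to products over primes\<close>

lemma filterlim_nat_floor: "filterlim (\<lambda>x::real. nat \<lfloor>x\<rfloor>) sequentially at_top"
  unfolding filterlim_at_top
proof
  fix n :: nat
  show "eventually (\<lambda>x::real. n \<le> nat \<lfloor>x\<rfloor>) at_top"
    using eventually_ge_at_top[of "real n"] by eventually_elim (simp add: le_nat_floor)
qed

lemma ln_ln_floor: "((\<lambda>x::real. ln (ln x) - ln (ln (real (nat \<lfloor>x\<rfloor>)))) \<longlongrightarrow> 0) at_top"
proof -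
  have "((\<lambda>x::real. ln (ln x) - ln (ln (of_int \<lfloor>x\<rfloor>))) \<longlongrightarrow> 0) at_top"
    by real_asymp
  then show ?thesis
    by (rule Lim_transform_eventually)
       (use eventually_ge_at_top[of 0] in eventually_elim, simp)
qed

lemma summable_inverse_square_bound:
  fixes f :: "nat \<Rightarrow> real"
  assumes "\<And>n. \<bar>f n\<bar> \<le> C / real n ^ 2"
  shows "summable f"
proof (rule summable_comparison_test)
  show "summable (\<lambda>n. C * (1 / real n ^ 2))"
    using inverse_power_summable[of 2, where 'a = real]
    by (intro summable_mult) (simp add: field_simps)
qed (use assms in auto)

text \<open>
  The logarithm of the product differs from \<open>- \<Sum> 1/n\<close> by an absolutely convergent series, since
  \<open>ln (1 - t) + t = O(t\<^sup>2)\<close>. The limit is an exponential, hence positive.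
\<close>

lemma mertens_product:
  fixes P :: "nat \<Rightarrow> bool" and c :: real
  assumes prime: "\<And>n. P n \<Longrightarrow> n \<ge> 2"
    and conv: "convergent (\<lambda>N. (\<Sum>n | n \<in> {2..N} \<and> P n. 1 / real n) - c * ln (ln (real N)))"
  shows "\<exists>C>0. ((\<lambda>x::real. ln x powr c * (\<Prod>n | P n \<and> real n \<le> x. 1 - 1 / real n)) \<longlongrightarrow> C) at_top"
proof -
  define h where "h n = (if P n then ln (1 - 1 / real n) + 1 / real n else 0)" for n
  have "summable h"
  proof (rule summable_inverse_square_bound)
    fix n
    show "\<bar>h n\<bar> \<le> 2 / real n ^ 2"
    proof (cases "P n")
      case True
      then have "\<bar>- (1 / real n)\<bar> \<le> 1 / 2" using prime[OF True] by (simp add: field_simps)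
      from abs_ln_one_plus_x_minus_x_bound[OF this] show ?thesis
        using True by (simp add: h_def power_divide)
    qed (simp add: h_def)
  qed
  then have "convergent (\<lambda>N. \<Sum>n<N. h n)"
    by (simp add: summable_iff_convergent)
  then have "convergent (\<lambda>N. \<Sum>n<N + 1. h n)"
    by (subst convergent_ignore_initial_segment)
  from convergent_diff[OF this conv] obtain l where
    l: "(\<lambda>N. (\<Sum>n<N + 1. h n) - ((\<Sum>n | n \<in> {2..N} \<and> P n. 1 / real n) - c * ln (ln (real N)))) \<longlonglongrightarrow> l"
    by (auto simp: convergent_def)
  have eq: "(\<Sum>n<N + 1. h n) - (\<Sum>n | n \<in> {2..N} \<and> P n. 1 / real n)
      = (\<Sum>n | n \<in> {2..N} \<and> P n. ln (1 - 1 / real n))" for N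
  proof -
    have "(\<Sum>n<N + 1. h n) = (\<Sum>n\<in>{n. n \<in> {2..N} \<and> P n}. ln (1 - 1 / real n) + 1 / real n)"
      using prime by (intro sum.mono_neutral_cong_right) (auto simp: h_def)
    then show ?thesis by (simp add: sum.distrib)
  qed
  have l': "(\<lambda>N. (\<Sum>n | n \<in> {2..N} \<and> P n. ln (1 - 1 / real n)) + c * ln (ln (real N))) \<longlonglongrightarrow> l"
    using l unfolding eq[symmetric] by (simp add: algebra_simps)
  have "((\<lambda>x. ((\<Sum>n | n \<in> {2..nat \<lfloor>x\<rfloor>} \<and> P n. ln (1 - 1 / real n)) + c * ln (ln (real (nat \<lfloor>x\<rfloor>))))
      + c * (ln (ln x) - ln (ln (real (nat \<lfloor>x\<rfloor>))))) \<longlongrightarrow> l + c * 0) at_top"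
    by (intro tendsto_intros filterlim_compose[OF l' filterlim_nat_floor] ln_ln_floor)
  then have "((\<lambda>x. (\<Sum>n | n \<in> {2..nat \<lfloor>x\<rfloor>} \<and> P n. ln (1 - 1 / real n)) + c * ln (ln x)) \<longlongrightarrow> l) at_top"
    by (simp add: algebra_simps)
  then have "((\<lambda>x. exp ((\<Sum>n | n \<in> {2..nat \<lfloor>x\<rfloor>} \<and> P n. ln (1 - 1 / real n)) + c * ln (ln x))) \<longlongrightarrow> exp l) at_top"
    by (intro tendsto_intros)
  then have "((\<lambda>x::real. ln x powr c * (\<Prod>n | P n \<and> real n \<le> x. 1 - 1 / real n)) \<longlongrightarrow> exp l) at_top"
  proof (rule Lim_transform_eventually)
    show "eventually (\<lambda>x. exp ((\<Sum>n | n \<in> {2..nat \<lfloor>x\<rfloor>} \<and> P n. ln (1 - 1 / real n)) + c * ln (ln x))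
        = ln x powr c * (\<Prod>n | P n \<and> real n \<le> x. 1 - 1 / real n)) at_top"
      using eventually_gt_at_top[of 1]
    proof eventually_elim
      fix x :: real assume x: "x > 1"
      have "{n. n \<in> {2..nat \<lfloor>x\<rfloor>} \<and> P n} = {n. P n \<and> real n \<le> x}"
        using x prime by (auto simp: le_nat_iff le_floor_iff)
      moreover have "exp (\<Sum>n | n \<in> {2..nat \<lfloor>x\<rfloor>} \<and> P n. ln (1 - 1 / real n))
          = (\<Prod>n | n \<in> {2..nat \<lfloor>x\<rfloor>} \<and> P n. 1 - 1 / real n)"
        by (subst exp_sum) (auto intro!: prod.cong)
      ultimately show "exp ((\<Sum>n | n \<in> {2..nat \<lfloor>x\<rfloor>} \<and> P n. ln (1 - 1 / real n)) + c * ln (ln x))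
        = ln x powr c * (\<Prod>n | P n \<and> real n \<le> x. 1 - 1 / real n)"
        using x by (simp add: exp_add powr_def mult.commute)
    qed
  qed
  then show ?thesis by (intro exI[of _ "exp l"]) simp
qed

lemma tendsto_prodinf_one_minus_inverse_square:
  fixes P :: "nat \<Rightarrow> bool"
  assumes ge_2: "\<And>n. P n \<Longrightarrow> n \<ge> 2"
  defines "D \<equiv> (\<Prod>n. if P n then 1 - 1 / (real n)\<^sup>2 else 1)"
  shows "D > 0" and "((\<lambda>x::real. \<Prod>n | P n \<and> real n \<le> x. 1 - 1 / (real n)\<^sup>2) \<longlongrightarrow> D) at_top"
proof -
  define d where "d n = (if P n then 1 - 1 / (real n)\<^sup>2 else 1)" for n
  have d_pos: "d n > 0" for n
  proof (cases "P n")
    case True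
    then have "real n ^ 2 > 1" using ge_2[OF True] by (simp add: one_less_power)
    then show ?thesis using True by (simp add: d_def divide_less_eq)
  qed (simp add: d_def)
  have "summable (\<lambda>n. \<bar>d n - 1\<bar>)"
    by (rule summable_inverse_square_bound[of _ 1]) (simp add: d_def)
  then have "convergent_prod (\<lambda>n. 1 + (d n - 1))"
    by (intro summable_imp_convergent_prod_real) (use d_pos in \<open>auto simp: less_le\<close>)
  then have conv: "convergent_prod d" by simp
  have D: "D = prodinf d" by (simp add: D_def d_def[abs_def])
  from convergent_prod_LIMSEQ[OF conv] have lim: "(\<lambda>n. \<Prod>i\<le>n. d i) \<longlonglongrightarrow> D" by (simp add: D)
  have "D \<noteq> 0" unfolding D using d_pos by (intro prodinf_nonzero conv) (metis less_irrefl)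
  moreover have "D \<ge> 0"
    by (rule LIMSEQ_le_const[OF lim]) (auto intro!: prod_nonneg less_imp_le[OF d_pos])
  ultimately show "D > 0" by simp
  have "((\<lambda>x::real. \<Prod>i\<le>nat \<lfloor>x\<rfloor>. d i) \<longlongrightarrow> D) at_top"
    by (rule filterlim_compose[OF lim filterlim_nat_floor])
  then show "((\<lambda>x::real. \<Prod>n | P n \<and> real n \<le> x. 1 - 1 / (real n)\<^sup>2) \<longlongrightarrow> D) at_top"
  proof (rule Lim_transform_eventually)
    show "eventually (\<lambda>x. (\<Prod>i\<le>nat \<lfloor>x\<rfloor>. d i) = (\<Prod>n | P n \<and> real n \<le> x. 1 - 1 / (real n)\<^sup>2)) at_top"
      using eventually_ge_at_top[of 0]
    proof eventually_elim
      fix x :: real assume "x \<ge> 0"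
      then show "(\<Prod>i\<le>nat \<lfloor>x\<rfloor>. d i) = (\<Prod>n | P n \<and> real n \<le> x. 1 - 1 / (real n)\<^sup>2)"
        by (intro prod.mono_neutral_cong_right) (auto simp: d_def le_nat_iff le_floor_iff)
    qed
  qed
qed

section \<open>The constants and the asymptotic formula\<close>

lemma totatives_twopow_odd:
  assumes "m \<ge> 2" "a \<in> totatives (2 ^ m)"
  shows "odd a" "a < 2 ^ m"
proof -
  have cop: "coprime a (2 ^ m)" and le: "a \<le> 2 ^ m" using assms(2) by (auto simp: totatives_def)
  show odd: "odd a" using cop assms(1) by (auto simp: coprime_power_right_iff)
  have "even (2 ^ m :: nat)" using assms(1) by simp
  then have "a \<noteq> 2 ^ m" using odd by metis
  then show "a < 2 ^ m" using le by simp
qed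

lemma C_const_twopow:
  assumes "m \<ge> 2" "a \<in> totatives (2 ^ m)"
  shows "C_const (2 ^ m) a > 0"
    and "((\<lambda>x. ln x powr (1 / real (totient (2 ^ m))) *
      (\<Prod>p | p \<in> odd_primes_upto x \<and> [p = a] (mod 2 ^ m). 1 - 1 / real p)) \<longlongrightarrow> C_const (2 ^ m) a) at_top"
proof -
  define P where "P n \<longleftrightarrow> prime n \<and> odd n \<and> [n = a] (mod 2 ^ m)" for n
  have odd: "odd a" using totatives_twopow_odd[OF assms] by blast
  have P_eq: "prime n \<and> [n = a] (mod 2 ^ m) \<longleftrightarrow> P n" for n
  proof -
    have "odd n" if "[n = a] (mod 2 ^ m)"
      using mod_4_eq_if_cong_twopow[OF assms(1) that] odd by presburger
    then show ?thesis by (auto simp: P_def)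
  qed
  have tot: "1 / real (totient (2 ^ m)) = 1 / 2 ^ (m - 1)"
    using assms(1) by (simp add: totient_prime_power)
  obtain C where "\<And>N. N \<ge> 1 \<Longrightarrow> \<bar>(\<Sum>n | n \<in> {1..N} \<and> P n. ln (real n) / real n)
           - ln (real N) / 2 ^ (m - 1)\<bar> \<le> C"
    using mertens_log_primes_twopow[OF assms(1) odd] unfolding P_eq by blast
  then have conv: "convergent (\<lambda>N. (\<Sum>n | n \<in> {2..N} \<and> P n. 1 / real n) - 1 / 2 ^ (m - 1) * ln (ln (real N)))"
    by (intro mertens_primes_if_log[of _ _ C]) simp
  have ge_2: "n \<ge> 2" if "P n" for n using that prime_ge_2_nat by (auto simp: P_def)
  obtain K where K: "K > 0"
      "((\<lambda>x::real. ln x powr (1 / 2 ^ (m - 1)) * (\<Prod>n | P n \<and> real n \<le> x. 1 - 1 / real n)) \<longlongrightarrow> K) at_top"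
    using mertens_product[of P, OF ge_2 conv] by blast
  have set_eq: "{p. p \<in> odd_primes_upto x \<and> [p = a] (mod 2 ^ m)} = {n. P n \<and> real n \<le> x}" for x
    by (auto simp: P_def odd_primes_upto_def)
  have lim: "((\<lambda>x. ln x powr (1 / real (totient (2 ^ m))) *
      (\<Prod>p | p \<in> odd_primes_upto x \<and> [p = a] (mod 2 ^ m). 1 - 1 / real p)) \<longlongrightarrow> K) at_top"
    unfolding set_eq tot by (rule K(2))
  have "C_const (2 ^ m) a = K"
    unfolding C_const_def by (rule tendsto_Lim[OF _ lim]) simp
  with K(1) lim show "C_const (2 ^ m) a > 0"
    and "((\<lambda>x. ln x powr (1 / real (totient (2 ^ m))) *
      (\<Prod>p | p \<in> odd_primes_upto x \<and> [p = a] (mod 2 ^ m). 1 - 1 / real p)) \<longlongrightarrow> C_const (2 ^ m) a) at_top"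
    by simp_all
qed

lemma D_const_pos: "D_const q a > 0"
  and D_const_tendsto: "((\<lambda>x. \<Prod>p | p \<in> odd_primes_upto x \<and> [p = a] (mod q). 1 - 1 / (real p)\<^sup>2)
      \<longlongrightarrow> D_const q a) at_top"
proof -
  define P where "P n \<longleftrightarrow> prime n \<and> odd n \<and> [n = a] (mod q)" for n
  have ge_2: "n \<ge> 2" if "P n" for n using that prime_ge_2_nat by (auto simp: P_def)
  have set_eq: "{p. p \<in> odd_primes_upto x \<and> [p = a] (mod q)} = {n. P n \<and> real n \<le> x}" for x
    by (auto simp: P_def odd_primes_upto_def)
  show "D_const q a > 0"
    using tendsto_prodinf_one_minus_inverse_square(1)[of P, OF ge_2] by (simp add: D_const_def P_def)
  show "((\<lambda>x. \<Prod>p | p \<in> odd_primes_upto x \<and> [p = a] (mod q). 1 - 1 / (real p)\<^sup>2)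
      \<longlongrightarrow> D_const q a) at_top"
    unfolding set_eq
    using tendsto_prodinf_one_minus_inverse_square(2)[of P, OF ge_2] by (simp add: D_const_def P_def)
qed

lemma chi4_cong: "[n = a] (mod 4) \<Longrightarrow> chi4 n = chi4 a"
  by (simp add: chi4_def cong_def)

lemma chi4_odd: "odd n \<Longrightarrow> chi4 n = 1 \<or> chi4 n = - 1"
proof -
  assume "odd n"
  then have "n mod 4 = 1 \<or> n mod 4 = 3" by presburger
  then show ?thesis by (auto simp: chi4_def cong_def)
qed

lemma A_factor_eq:
  assumes "p \<ge> 2" "chi4 (int p) = s" "s = 1 \<or> s = - 1"
  shows "A_factor p = ((1 - 1 / real p) ^ 2 / (1 - 1 / (real p)\<^sup>2)) powi s"
proof -
  have p: "real p > 1" using assms by simp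
  have "(1 - 1 / real p) ^ 2 = ((real p - 1) / real p) ^ 2"
    using p by (simp add: field_simps)
  moreover have "1 - 1 / (real p)\<^sup>2 = (real p - 1) * (real p + 1) / real p ^ 2"
    using p by (simp add: field_simps power2_eq_square)
  ultimately have eq: "(1 - 1 / real p) ^ 2 / (1 - 1 / (real p)\<^sup>2) = (real p - 1) / (real p + 1)"
    using p by (simp add: power_divide power2_eq_square)
  show ?thesis
    unfolding eq using assms by (auto simp: A_factor_def power_int_minus)
qed

lemma prod_powi: "(\<Prod>x\<in>A. f x powi s) = (\<Prod>x\<in>A. f x) powi s" for f :: "'b \<Rightarrow> real"
  by (induction A rule: infinite_finite_induct) (simp_all add: power_int_mult_distrib)

lemma finite_odd_primes_upto: "finite (odd_primes_upto x)"
proof (rule finite_subset)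
  show "odd_primes_upto x \<subseteq> {..nat \<lfloor>x\<rfloor>}"
    by (auto simp: odd_primes_upto_def le_nat_floor)
qed simp

lemma P_prod_eq:
  assumes "m \<ge> 2" "S \<subseteq> totatives (2 ^ m)"
  shows "P_prod (2 ^ m) S x = (\<Prod>a\<in>S.
     ((\<Prod>p | p \<in> odd_primes_upto x \<and> [p = a] (mod 2 ^ m). 1 - 1 / real p) ^ 2
      / (\<Prod>p | p \<in> odd_primes_upto x \<and> [p = a] (mod 2 ^ m). 1 - 1 / (real p)\<^sup>2)) powi chi4 (int a))"
proof -
  let ?A = "\<lambda>a. {p. p \<in> odd_primes_upto x \<and> [p = a] (mod 2 ^ m)}"
  have odd: "odd a" and less: "a < 2 ^ m" if "a \<in> S" for a
    using totatives_twopow_odd[OF assms(1)] assms(2) that by blast+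
  have fin: "finite S" using assms(2) finite_subset finite_totatives by blast
  have "{p. p \<in> odd_primes_upto x \<and> p mod 2 ^ m \<in> S} = (\<Union>a\<in>S. ?A a)"
    using less by (auto simp: cong_def)
  then have "P_prod (2 ^ m) S x = (\<Prod>p\<in>(\<Union>a\<in>S. ?A a). A_factor p)"
    by (simp add: P_prod_def)
  also have "\<dots> = (\<Prod>a\<in>S. \<Prod>p\<in>?A a. A_factor p)"
    using fin finite_odd_primes_upto less by (intro prod.UNION_disjoint) (auto simp: cong_def)
  also have "\<dots> = (\<Prod>a\<in>S. ((\<Prod>p\<in>?A a. 1 - 1 / real p) ^ 2
      / (\<Prod>p\<in>?A a. 1 - 1 / (real p)\<^sup>2)) powi chi4 (int a))"
  proof (intro prod.cong refl)
    fix a assume a: "a \<in> S"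
    have "(\<Prod>p\<in>?A a. A_factor p)
        = (\<Prod>p\<in>?A a. ((1 - 1 / real p) ^ 2 / (1 - 1 / (real p)\<^sup>2)) powi chi4 (int a))"
    proof (intro prod.cong refl A_factor_eq chi4_odd chi4_cong)
      fix p assume p: "p \<in> ?A a"
      then show "p \<ge> 2" using prime_ge_2_nat by (auto simp: odd_primes_upto_def)
      show "odd (int a)" using odd[OF a] by simp
      have "p mod 4 = a mod 4" using p mod_4_eq_if_cong_twopow[OF assms(1)] by auto
      then have "[p = a] (mod 4)" by (simp add: cong_def)
      then show "[int p = int a] (mod 4)" by (metis cong_int_iff of_nat_numeral)
    qed
    then show "(\<Prod>p\<in>?A a. A_factor p) = ((\<Prod>p\<in>?A a. 1 - 1 / real p) ^ 2
      / (\<Prod>p\<in>?A a. 1 - 1 / (real p)\<^sup>2)) powi chi4 (int a)"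
      by (simp only: prod_powi prod_dividef prod_power_distrib)
  qed
  finally show ?thesis .
qed

text \<open>
  Each truncated product of \<open>1 - 1/p\<close> is normalised by its own power of \<open>ln x\<close>. In the product over the classes these
  powers are squared and carry the signs \<open>chi4 a\<close>, so that their exponents add up to
  \<open>2 \<mu>(S) / \<phi>(q)\<close>.
\<close>

lemma P_prod_tendsto:
  assumes "m \<ge> 2" "S \<subseteq> totatives (2 ^ m)"
  shows "((\<lambda>x. P_prod (2 ^ m) S x * ln x powr (2 * of_int (mu_sum S) / real (totient (2 ^ m))))
    \<longlongrightarrow> (\<Prod>a\<in>S. ((C_const (2 ^ m) a)\<^sup>2 / D_const (2 ^ m) a) powi chi4 (int a))) at_top"
proof -
  let ?q = "2 ^ m :: nat"
  let ?c = "1 / real (totient ?q)"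
  define E where "E a x = (\<Prod>p | p \<in> odd_primes_upto x \<and> [p = a] (mod ?q). 1 - 1 / real p)" for a x
  define F where "F a x = (\<Prod>p | p \<in> odd_primes_upto x \<and> [p = a] (mod ?q). 1 - 1 / (real p)\<^sup>2)" for a x
  have "((\<lambda>x. \<Prod>a\<in>S. ((ln x powr ?c * E a x)\<^sup>2 / F a x) powi chi4 (int a))
    \<longlongrightarrow> (\<Prod>a\<in>S. ((C_const ?q a)\<^sup>2 / D_const ?q a) powi chi4 (int a))) at_top"
  proof (rule tendsto_prod)
    fix a assume "a \<in> S"
    then have a: "a \<in> totatives ?q" using assms(2) by blast
    have C: "((\<lambda>x. ln x powr ?c * E a x) \<longlongrightarrow> C_const ?q a) at_top"
      unfolding E_def by (rule C_const_twopow(2)[OF assms(1) a])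
    have D: "(F a \<longlongrightarrow> D_const ?q a) at_top"
      unfolding F_def[abs_def] by (rule D_const_tendsto)
    have nz: "(C_const ?q a)\<^sup>2 / D_const ?q a \<noteq> 0" "D_const ?q a \<noteq> 0"
      using C_const_twopow(1)[OF assms(1) a] D_const_pos[of ?q a] by auto
    show "((\<lambda>x. ((ln x powr ?c * E a x)\<^sup>2 / F a x) powi chi4 (int a))
      \<longlongrightarrow> ((C_const ?q a)\<^sup>2 / D_const ?q a) powi chi4 (int a)) at_top"
      by (intro tendsto_power_int tendsto_divide tendsto_power C D nz)
  qed
  then show ?thesis
  proof (rule Lim_transform_eventually)
    show "eventually (\<lambda>x. (\<Prod>a\<in>S. ((ln x powr ?c * E a x)\<^sup>2 / F a x) powi chi4 (int a))
       = P_prod ?q S x * ln x powr (2 * of_int (mu_sum S) / real (totient ?q))) at_top"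
      using eventually_gt_at_top[of 1]
    proof eventually_elim
      fix x :: real assume x: "x > 1"
      have fin: "finite S" using assms(2) finite_subset finite_totatives by blast
      have "((ln x powr ?c * E a x)\<^sup>2 / F a x) powi chi4 (int a)
          = ((E a x)\<^sup>2 / F a x) powi chi4 (int a) * ln x powr (2 * ?c * of_int (chi4 (int a)))" for a
      proof -
        have "(ln x powr ?c * E a x)\<^sup>2 / F a x = (E a x)\<^sup>2 / F a x * ln x powr (2 * ?c)"
          by (simp add: power_mult_distrib power2_eq_square powr_add[symmetric])
        moreover have "(ln x powr (2 * ?c)) powi k = ln x powr (2 * ?c * of_int k)" for k
          using x by (simp add: powr_powr flip: powr_real_of_int')
        ultimately show ?thesis by (simp only: power_int_mult_distrib)
      qed
      then have "(\<Prod>a\<in>S. ((ln x powr ?c * E a x)\<^sup>2 / F a x) powi chi4 (int a))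
         = P_prod ?q S x * (\<Prod>a\<in>S. ln x powr (2 * ?c * of_int (chi4 (int a))))"
        unfolding P_prod_eq[OF assms] E_def F_def by (simp only: prod.distrib)
      also have "(\<Prod>a\<in>S. ln x powr (2 * ?c * of_int (chi4 (int a))))
          = ln x powr (\<Sum>a\<in>S. 2 * ?c * of_int (chi4 (int a)))"
        using x fin by (subst powr_sum) auto
      also have "(\<Sum>a\<in>S. 2 * ?c * of_int (chi4 (int a))) = 2 * of_int (mu_sum S) / real (totient ?q)"
        by (simp add: mu_sum_def sum_distrib_left sum_divide_distrib)
      finally show "(\<Prod>a\<in>S. ((ln x powr ?c * E a x)\<^sup>2 / F a x) powi chi4 (int a))
       = P_prod ?q S x * ln x powr (2 * of_int (mu_sum S) / real (totient ?q))" .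
    qed
  qed
qed

theorem theorem2:
  fixes q m :: nat and S :: "nat set"
  assumes "m \<ge> 2" and "q = 2 ^ m" and "S \<subseteq> totatives q"
  shows "P_prod q S \<sim>[at_top]
           (\<lambda>x::real. (\<Prod>a\<in>S. ((C_const q a)\<^sup>2 / D_const q a) powi chi4 (int a)) *
              ln x powr (- 2 * of_int (mu_sum S) / real (totient q)))
       \<and> (\<exists>!K. is_leading_const q S K)
       \<and> K_const q S = (\<Prod>a\<in>S. ((C_const q a)\<^sup>2 / D_const q a) powi chi4 (int a))
       \<and> (mu_sum S = 0 \<longrightarrow>
           (P_prod q S \<longlongrightarrow>
              (\<Prod>a\<in>S. ((C_const q a)\<^sup>2 / D_const q a) powi chi4 (int a))) at_top)"
proof -
  define K where "K = (\<Prod>a\<in>S. ((C_const q a)\<^sup>2 / D_const q a) powi chi4 (int a))"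
  define e where "e = 2 * of_int (mu_sum S) / real (totient q)"
  have e': "- 2 * of_int (mu_sum S) / real (totient q) = - e" by (simp add: e_def)
  have lim: "((\<lambda>x. P_prod q S x * ln x powr e) \<longlongrightarrow> K) at_top"
    unfolding K_def e_def assms(2) using assms by (intro P_prod_tendsto) auto
  have "K > 0"
    unfolding K_def using C_const_twopow(1)[OF assms(1)] D_const_pos[of q] assms(2,3)
    by (intro prod_pos zero_less_power_int divide_pos_pos zero_less_power) auto
  \<comment> \<open>A quotient of the two sides tends to \<open>K / K'\<close>, which gives both the asymptotics and the uniqueness of the constant.\<close>
  have equiv_iff: "P_prod q S \<sim>[at_top] (\<lambda>x. K' * ln x powr (- e)) \<longleftrightarrow> K' = K" if "K' > 0" for K'
  proof -
    have ev: "eventually (\<lambda>x::real. P_prod q S x * ln x powr e / K' = P_prod q S x / (K' * ln x powr (- e))) at_top"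
      using eventually_gt_at_top[of 1]
      by eventually_elim (simp add: powr_minus field_simps)
    have "((\<lambda>x. P_prod q S x * ln x powr e / K') \<longlongrightarrow> K / K') at_top"
      using that by (intro tendsto_divide lim tendsto_const) auto
    then have lim': "((\<lambda>x. P_prod q S x / (K' * ln x powr (- e))) \<longlongrightarrow> K / K') at_top"
      by (rule Lim_transform_eventually[OF _ ev])
    show ?thesis
    proof
      assume "K' = K"
      then show "P_prod q S \<sim>[at_top] (\<lambda>x. K' * ln x powr (- e))"
        using lim' that by (intro asymp_equivI') simp
    next
      assume equiv: "P_prod q S \<sim>[at_top] (\<lambda>x. K' * ln x powr (- e))"
      have "eventually (\<lambda>x::real. K' * ln x powr (- e) \<noteq> 0) at_top"
        using eventually_gt_at_top[of 1] by eventually_elim (use that in auto)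
      then have "((\<lambda>x. P_prod q S x / (K' * ln x powr (- e))) \<longlongrightarrow> 1) at_top"
        by (intro asymp_equivD_strong[OF equiv]) (auto elim: eventually_mono)
      then have "K / K' = 1"
        using lim' tendsto_unique[OF _ lim'] by (metis trivial_limit_at_top_linorder)
      then show "K' = K" using that by simp
    qed
  qed
  have leading: "is_leading_const q S K' \<longleftrightarrow> K' = K" for K'
    unfolding is_leading_const_def e' using equiv_iff \<open>K > 0\<close> by blast
  have "K_const q S = K"
    unfolding K_const_def leading by simp
  moreover have "\<exists>!K'. is_leading_const q S K'"
    unfolding leading by simp
  moreover have "P_prod q S \<sim>[at_top] (\<lambda>x. K * ln x powr (- e))"
    using equiv_iff[OF \<open>K > 0\<close>] by simp
  moreover have "(P_prod q S \<longlongrightarrow> K) at_top" if "mu_sum S = 0"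
  proof -
    have "eventually (\<lambda>x::real. P_prod q S x * ln x powr e = P_prod q S x) at_top"
      using eventually_gt_at_top[of 1] by eventually_elim (use that in \<open>simp add: e_def\<close>)
    then show ?thesis by (rule Lim_transform_eventually[OF lim])
  qed
  ultimately show ?thesis
    unfolding K_def[symmetric] e' by blast
qed

end
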